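(* Let $H\in(0,1)$ and let $B^1_H,B^2_H,B^3_H$ be independent fractional Brownian motions with Hurst parameter $H$. The process $$J^2_F(t)=B^1_H\left(\left|B^2_H\left(|B^3_H(t)|^{1/H}\right)\right|^{1/H}\right),\qquad t>0,$$ has a probability density $$p^2(x,t)=4\int_0^\infty\frac{e^{-x^2/(2s^2)}}{\sqrt{2\pi s^2}}\int_0^\infty\frac{e^{-s^2/(2z^2)}}{\sqrt{2\pi z^2}}\,\frac{e^{-z^2/(2t^{2H})}}{\sqrt{2\pi t^{2H}}}\,dz\,ds=2\int_0^\infty\frac{e^{-x^2/(2s^2)}}{\sqrt{2\pi s^2}}\,\frac{1}{\pi t^H}K_0\!\left(\frac{s}{t^H}\right)ds,\qquad x\in\mathbb{R},\ t>0,$$ satisfying the fourth-order partial differential equation $$\frac{\partial}{\partial t}p^2(x,t)=Ht^{2H-1}\left\{4\frac{\partial^2}{\partial x^2}+5x\frac{\partial^3}{\partial x^3}+x^2\frac{\partial^4}{\partial x^4}\right\}p^2(x,t)$$ for $x\neq0$, $t>0$.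
   Context: A fractional Brownian motion $B_H$ with Hurst parameter $H\in(0,1)$ is a centred Gaussian process with covariance $E\{B_H(s)B_H(t)\}=\frac12\left(|t|^{2H}+|s|^{2H}-|t-s|^{2H}\right)$. $K_0$ is the modified Bessel function $K_0(x)=\int_0^\infty s^{-1}e^{-\frac{x^2}{4s^2}-s^2}\,ds$, $x>0$. (At the single point $x=0$ the integrals defining $p^2$ take the value $+\infty$.)
   Formalization: The fractional Brownian motions are assumed to have continuous sample paths; for a Gaussian process with only the stated covariance, the composed process need not have this density (set the outer process to 0 at the random time). *)

theory Defs
  imports "HOL-Probability.Probability"
begin

text \<open>Degenerate (almost surely constant) variables count as Gaussian, as is usual for Gaussian
  processes; for instance a fractional Brownian motion vanishes almost surely at time 0.\<close>

definition gaussian_rv :: "'a measure \<Rightarrow> ('a \<Rightarrow> real) \<Rightarrow> bool" where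
  "gaussian_rv M X \<longleftrightarrow>
     X \<in> borel_measurable M \<and>
     ((\<exists>\<mu> \<sigma>. 0 < \<sigma> \<and> distributed M lborel X (\<lambda>x. ennreal (normal_density \<mu> \<sigma> x))) \<or>
      (\<exists>c. AE \<omega> in M. X \<omega> = c))"

definition gaussian_process :: "'a measure \<Rightarrow> real set \<Rightarrow> (real \<Rightarrow> 'a \<Rightarrow> real) \<Rightarrow> bool" where
  "gaussian_process M T X \<longleftrightarrow>
     (\<forall>F a. finite F \<and> F \<subseteq> T \<longrightarrow> gaussian_rv M (\<lambda>\<omega>. \<Sum>t\<in>F. a t * X t \<omega>))"

text \<open>The time set is the half-line, the only times at which the iterated process below evaluates
  its components; a two-sided fractional Brownian motion restricts to one in this sense.
  Continuity of the sample paths is part of the definition: the law of a process evaluated at a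
  random time is not determined by finite-dimensional distributions alone.\<close>

definition fractional_brownian_motion ::
    "'a measure \<Rightarrow> real \<Rightarrow> (real \<Rightarrow> 'a \<Rightarrow> real) \<Rightarrow> bool" where
  "fractional_brownian_motion M H B \<longleftrightarrow>
     gaussian_process M {0..} B \<and>
     (\<forall>t\<ge>0. prob_space.expectation M (B t) = 0) \<and>
     (\<forall>s\<ge>0. \<forall>t\<ge>0. prob_space.expectation M (\<lambda>\<omega>. B s \<omega> * B t \<omega>) =
        1 / 2 * (\<bar>t\<bar> powr (2 * H) + \<bar>s\<bar> powr (2 * H) - \<bar>t - s\<bar> powr (2 * H))) \<and>
     (\<forall>\<omega>\<in>space M. continuous_on {0..} (\<lambda>t. B t \<omega>))"

text \<open>Independence of whole processes: each path is a random element of the product space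
  of real functions on the half-line with the cylinder sigma-algebra.\<close>

definition independent_processes ::
    "'a measure \<Rightarrow> 'i set \<Rightarrow> ('i \<Rightarrow> real \<Rightarrow> 'a \<Rightarrow> real) \<Rightarrow> bool" where
  "independent_processes M I B \<longleftrightarrow>
     prob_space.indep_vars M (\<lambda>_. PiM {0..} (\<lambda>_. borel :: real measure))
       (\<lambda>i \<omega>. \<lambda>t\<in>{0..}. B i t \<omega>) I"

definition iterated_fbm ::
    "real \<Rightarrow> (nat \<Rightarrow> real \<Rightarrow> 'a \<Rightarrow> real) \<Rightarrow> real \<Rightarrow> 'a \<Rightarrow> real" where
  "iterated_fbm H B t \<omega> =
     B 1 (\<bar>B 2 (\<bar>B 3 t \<omega>\<bar> powr (1 / H)) \<omega>\<bar> powr (1 / H)) \<omega>"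

definition bessel_K0 :: "real \<Rightarrow> real" where
  "bessel_K0 x = (LBINT s:{0<..}. 1 / s * exp (- (x\<^sup>2 / (4 * s\<^sup>2)) - s\<^sup>2))"

text \<open>The density takes values in the extended nonnegative reals, since the integral diverges
  at \<open>x = 0\<close>.\<close>

definition p2 :: "real \<Rightarrow> real \<Rightarrow> real \<Rightarrow> ennreal" where
  "p2 H x t =
     4 * (\<integral>\<^sup>+ s\<in>{0<..}.
            ennreal (exp (- (x\<^sup>2 / (2 * s\<^sup>2))) / sqrt (2 * pi * s\<^sup>2)) *
            (\<integral>\<^sup>+ z\<in>{0<..}.
               ennreal (exp (- (s\<^sup>2 / (2 * z\<^sup>2))) / sqrt (2 * pi * z\<^sup>2)) *
               ennreal (exp (- (z\<^sup>2 / (2 * t powr (2 * H)))) / sqrt (2 * pi * t powr (2 * H)))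
             \<partial>lborel)
          \<partial>lborel)"

end

theory Submission
  imports Defs
begin

text \<open>
  By independence and the scaling of the marginals, \<open>J(t)\<close> is distributed as a product of three
  independent centred Gaussians, and Tonelli's theorem gives the double integral as its density.
  Independence of path and random time is exploited through a jointly measurable version of the
  evaluation map.

  For the differential equation, pass to logarithmic coordinates. With \<open>\<psi>(u) = \<phi>(exp u)\<close>, where
  \<open>\<phi>\<close> is the standard normal density, the density becomes \<open>4 / t^H * G(ln \<bar>x\<bar> - H ln t)\<close> with
  \<open>G\<close> the threefold convolution of \<open>\<psi>\<close>. Since \<open>\<psi>' = - exp (2u) \<psi>\<close> and the weight
  \<open>exp (2u)\<close> is multiplicative under convolution, letting one derivative fall on each factor yields
  \<open>G''' = - exp (2u) G\<close>; the equation for \<open>p\<^sup>2\<close> is this identity, differentiated once and rewritten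
  by the chain rule.
\<close>

section \<open>Gaussian convolutions in logarithmic coordinates\<close>

text \<open>The mean value inequality on the convex set bounds every difference quotient by
  \<open>g\<close>; dominated convergence along sequences tending to \<open>x\<close> then gives the
  limit.\<close>

lemma has_real_derivative_integral_dominated:
  fixes f :: "real \<Rightarrow> 'b \<Rightarrow> real"
  assumes S: "open S" "convex S" "x \<in> S"
    and f: "\<And>u. u \<in> S \<Longrightarrow> integrable M (f u)"
    and f': "\<And>u a. u \<in> S \<Longrightarrow> ((\<lambda>u. f u a) has_real_derivative f' u a) (at u)"
    and meas: "f' x \<in> borel_measurable M"
    and g: "integrable M g" "\<And>u a. u \<in> S \<Longrightarrow> \<bar>f' u a\<bar> \<le> g a"
  shows "((\<lambda>u. \<integral>a. f u a \<partial>M) has_real_derivative (\<integral>a. f' x a \<partial>M)) (at x)"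
proof -
  have "((\<lambda>y. ((\<integral>a. f y a \<partial>M) - (\<integral>a. f x a \<partial>M)) / (y - x)) \<longlongrightarrow> (\<integral>a. f' x a \<partial>M)) (at x within S)"
    unfolding tendsto_at_iff_sequentially comp_def
  proof (intro allI impI)
    fix X assume X: "\<forall>i. X i \<in> S - {x}" "X \<longlonglongrightarrow> x"
    have "(\<lambda>i. \<integral>a. (f (X i) a - f x a) / (X i - x) \<partial>M) \<longlonglongrightarrow> (\<integral>a. f' x a \<partial>M)"
    proof (rule integral_dominated_convergence[where w = g])
      show "(\<lambda>a. (f (X i) a - f x a) / (X i - x)) \<in> borel_measurable M" for i
        using X(1) S(3) f[THEN borel_measurable_integrable] by (intro measurable) auto
      show "AE a in M. (\<lambda>i. (f (X i) a - f x a) / (X i - x)) \<longlonglongrightarrow> f' x a"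
      proof (rule AE_I2)
        fix a
        have "((\<lambda>y. (f y a - f x a) / (y - x)) \<longlongrightarrow> f' x a) (at x)"
          using f'[OF S(3), of a] by (simp add: has_field_derivative_iff)
        then show "(\<lambda>i. (f (X i) a - f x a) / (X i - x)) \<longlonglongrightarrow> f' x a"
          using X unfolding tendsto_at_iff_sequentially comp_def by auto
      qed
      show "AE a in M. norm ((f (X i) a - f x a) / (X i - x)) \<le> g a" for i
      proof (rule AE_I2)
        fix a
        have "norm (f (X i) a - f x a) \<le> g a * norm (X i - x)"
          using X(1) S f' g(2)
          by (intro field_differentiable_bound[where S = S and f' = "\<lambda>u. f' u a"])
             (auto intro: has_field_derivative_at_within)
        then show "norm ((f (X i) a - f x a) / (X i - x)) \<le> g a"
          using X(1) by (simp add: field_simps)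
      qed
    qed (use meas g in auto)
    moreover have "(\<integral>a. (f (X i) a - f x a) / (X i - x) \<partial>M) =
        ((\<integral>a. f (X i) a \<partial>M) - (\<integral>a. f x a \<partial>M)) / (X i - x)" for i
      using f[of "X i"] f[OF S(3)] X(1) by (subst Bochner_Integration.integral_diff[symmetric]) auto
    ultimately show "(\<lambda>i. ((\<integral>a. f (X i) a \<partial>M) - (\<integral>a. f x a \<partial>M)) / (X i - x)) \<longlonglongrightarrow> (\<integral>a. f' x a \<partial>M)"
      by (simp only:)
  qed
  then show ?thesis
    by (simp add: has_field_derivative_iff at_within_open[OF S(3,1)])
qed

lemma powr_2H: "t > 0 \<Longrightarrow> t powr (2 * H) = (t powr H)\<^sup>2" for t H :: real
  by (simp add: powr_power mult.commute)

text \<open>This is the common majorant for the dominations below. The exponential density plus its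
  reflection bounds it.\<close>

lemma integrable_exp_minus_abs: "integrable lborel (\<lambda>a::real. exp (- \<bar>a\<bar>))"
proof -
  interpret prob_space "density lborel (exponential_density 1)"
    by (rule prob_space_exponential_density) simp
  have "integrable (density lborel (exponential_density 1)) (\<lambda>x::real. 1::real)"
    by simp
  then have 1: "integrable lborel (exponential_density 1)"
    by (subst (asm) integrable_density) (auto simp: exponential_density_nonneg)
  have "integrable lborel (\<lambda>a. exponential_density 1 (0 + (-1) * a))"
    by (rule lborel_integrable_real_affine[OF 1]) simp
  with 1 have "integrable lborel (\<lambda>a. exponential_density 1 a + exponential_density 1 (- a))"
    by simp
  then show ?thesis
    by (rule Bochner_Integration.integrable_bound) (auto simp: exponential_density_def)
qed

text \<open>The psi of the overview. No Jacobian is built in: the factor \<open>exp a\<close>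
  produced by the logarithmic substitution cancels the \<open>1 / z\<close> of the Gaussian
  kernel.\<close>

definition log_gauss :: "real \<Rightarrow> real" where
  "log_gauss u = exp (- (exp u)\<^sup>2 / 2) / sqrt (2 * pi)"

lemma log_gauss_pos: "0 < log_gauss u"
  by (simp add: log_gauss_def)

lemma log_gauss_measurable [measurable]: "log_gauss \<in> borel_measurable borel"
  unfolding log_gauss_def by measurable

text \<open>For \<open>u \<ge> 0\<close> the doubly exponential decay beats every exponential; for
  \<open>u < 0\<close> the right-hand side is at least 1, which already bounds
  \<open>log_gauss\<close>.\<close>

lemma log_gauss_le_exp: "\<exists>C>0. \<forall>u. log_gauss u \<le> C * exp (- real k * u)"
proof (intro exI conjI allI)
  \<comment> \<open>The power \<open>(2 * k) ^ k\<close> comes from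
    \<open>y ^ k \<le> k ^ k * exp y\<close> at \<open>y = exp (2 * u) / 2\<close>; the 1 serves
    negative \<open>u\<close>.\<close>
  let ?C = "max 1 ((2 * real k) ^ k)"
  show "0 < ?C" by simp
  fix u :: real
  have le: "log_gauss u \<le> exp (- (exp u)\<^sup>2 / 2)"
  proof -
    have "1 \<le> sqrt (2 * pi)" using pi_ge_two by simp
    then show ?thesis unfolding log_gauss_def by (simp add: divide_le_eq)
  qed
  show "log_gauss u \<le> ?C * exp (- real k * u)"
  proof (cases "u \<ge> 0")
    case True
    let ?y = "(exp u)\<^sup>2 / 2"
    have "(?y / k) ^ k \<le> exp ?y"
    proof (cases "k = 0")
      case False
      have "(?y / k) ^ k \<le> (1 + ?y / k) ^ k" by (intro power_mono) auto
      also have "\<dots> \<le> exp ?y"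
        using False by (intro exp_ge_one_plus_x_over_n_power_n) (auto intro: order_trans[of _ 0])
      finally show ?thesis .
    qed simp
    then have "((exp u)\<^sup>2) ^ k * exp (- (exp u)\<^sup>2 / 2) \<le> (2 * real k) ^ k"
      by (cases "k = 0") (simp_all add: exp_minus power_divide field_simps)
    moreover have "((exp u)\<^sup>2) ^ k = exp (real k * u) * exp (real k * u)"
      by (simp add: exp_of_nat_mult power2_eq_square power_mult_distrib)
    ultimately have "exp (- (exp u)\<^sup>2 / 2) \<le> (2 * real k) ^ k * exp (- real k * u) * exp (- real k * u)"
      by (simp add: exp_minus field_simps)
    also have "\<dots> \<le> ?C * exp (- real k * u) * 1"
      using True by (intro mult_mono) auto
    finally show ?thesis using le by simp
  next
    case False
    have "log_gauss u \<le> 1" using le by (rule order_trans) simp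
    also have "1 \<le> exp (- real k * u)" using False by (simp add: mult_nonneg_nonpos)
    also have "\<dots> \<le> ?C * exp (- real k * u)" by simp
    finally show ?thesis .
  qed
qed

definition log_gauss' :: "real \<Rightarrow> real" where
  "log_gauss' u = - exp (2 * u) * log_gauss u"

lemma log_gauss_deriv: "(log_gauss has_real_derivative log_gauss' u) (at u)"
proof -
  have "((\<lambda>u. exp (- (exp u)\<^sup>2 / 2)) has_real_derivative - exp (2 * u) * exp (- (exp u)\<^sup>2 / 2)) (at u)"
    by (rule derivative_eq_intros refl | simp)+ (simp add: power2_eq_square exp_add[symmetric])
  from DERIV_cdivide[OF this, of "sqrt (2 * pi)"] show ?thesis
    unfolding log_gauss_def[abs_def] log_gauss'_def by simp
qed

text \<open>With \<open>y = exp a\<close> the condition says that \<open>y ^ k * h\<close> is bounded for \<open>k \<ge> 1\<close>. The case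
  \<open>k = 0\<close> is left out because the density of a product of two Gaussians has a logarithmic
  singularity at \<open>y = 0\<close>.\<close>

definition tame :: "(real \<Rightarrow> real) \<Rightarrow> bool" where
  "tame h \<longleftrightarrow> h \<in> borel_measurable borel \<and>
     (\<forall>k\<ge>1. \<exists>C>0. \<forall>a. \<bar>h a\<bar> \<le> C * exp (- real k * a))"

lemma tame_measurable: "tame h \<Longrightarrow> h \<in> borel_measurable borel"
  by (simp add: tame_def)

text \<open>The weight costs \<open>m\<close> orders of decay, and bounds of every order are
  available.\<close>

lemma tame_exp_mult:
  assumes "tame h" shows "tame (\<lambda>a. exp (real m * a) * h a)"
  unfolding tame_def
proof (intro conjI allI impI)
  have [measurable]: "h \<in> borel_measurable borel" using assms by (rule tame_measurable)
  show "(\<lambda>a. exp (real m * a) * h a) \<in> borel_measurable borel" by measurable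
  fix k :: nat assume "1 \<le> k"
  then obtain C where C: "C > 0" "\<And>a. \<bar>h a\<bar> \<le> C * exp (- real (k + m) * a)"
    using assms unfolding tame_def by (meson trans_le_add1)
  have "\<bar>exp (real m * a) * h a\<bar> \<le> C * exp (- real k * a)" for a
  proof -
    have "\<bar>exp (real m * a) * h a\<bar> \<le> exp (real m * a) * (C * exp (- real (k + m) * a))"
      using C(2)[of a] by (simp add: abs_mult)
    also have "\<dots> = C * exp (- real k * a)"
      by (simp add: exp_add[symmetric] algebra_simps)
    finally show ?thesis .
  qed
  with C(1) show "\<exists>C>0. \<forall>a. \<bar>exp (real m * a) * h a\<bar> \<le> C * exp (- real k * a)" by blast
qed

lemma tame_uminus: "tame h \<Longrightarrow> tame (\<lambda>a. - h a)"
  by (auto simp: tame_def)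

lemma tame_log_gauss: "tame log_gauss"
  unfolding tame_def using log_gauss_le_exp log_gauss_pos by (auto simp: abs_of_pos)

lemma tame_log_gauss': "tame log_gauss'"
  using tame_uminus[OF tame_exp_mult[OF tame_log_gauss, of 2]] unfolding log_gauss'_def by simp

lemma kernel_bounds:
  obtains A where "A > 0" "\<And>v. log_gauss v \<le> A" "\<And>v. log_gauss v \<le> A * exp (- 2 * v)"
    "\<And>v. \<bar>log_gauss' v\<bar> \<le> A" "\<And>v. \<bar>log_gauss' v\<bar> \<le> A * exp (- 2 * v)"
proof -
  \<comment> \<open>The factor \<open>exp (2 * v)\<close> in \<open>log_gauss'\<close> costs two
    orders, so its bounds of order 0 and 2 rest on orders 2 and 4 of
    \<open>log_gauss\<close>.\<close>
  obtain A0 A2 A4 where A: "A0 > 0" "A2 > 0" "A4 > 0" "\<And>v. log_gauss v \<le> A0 * exp (- real 0 * v)"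
    "\<And>v. log_gauss v \<le> A2 * exp (- real 2 * v)" "\<And>v. log_gauss v \<le> A4 * exp (- real 4 * v)"
    using log_gauss_le_exp[of 0] log_gauss_le_exp[of 2] log_gauss_le_exp[of 4] by metis
  let ?A = "A0 + A2 + A4"
  have e: "exp (2 * v) * (c * exp (- real 2 * v)) = c" "exp (2 * v) * (c * exp (- real 4 * v)) = c * exp (- 2 * v)"
    for c v :: real by (simp_all add: exp_add[symmetric])
  have abs: "\<bar>log_gauss' v\<bar> = exp (2 * v) * log_gauss v" for v
    using log_gauss_pos[of v] by (simp add: log_gauss'_def abs_mult)
  show ?thesis
  proof (rule that[of ?A])
    fix v
    show "log_gauss v \<le> ?A" using A(1-3) A(4)[of v] by simp
    show "log_gauss v \<le> ?A * exp (- 2 * v)"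
      using A(5)[of v] A(1-3) by (simp add: distrib_right) (smt (verit) exp_gt_zero mult_nonneg_nonneg)
    show "\<bar>log_gauss' v\<bar> \<le> ?A"
      using mult_left_mono[OF A(5)[of v], of "exp (2 * v)"] A(1-3) e(1)[of v A2] unfolding abs by (smt (verit) exp_gt_zero)
    have "\<bar>log_gauss' v\<bar> \<le> A4 * exp (- 2 * v)"
      using mult_left_mono[OF A(6)[of v], of "exp (2 * v)"] e(2)[of v A4] unfolding abs by (smt (verit) exp_gt_zero)
    also have "\<dots> \<le> ?A * exp (- 2 * v)" using A(1-3) by (intro mult_right_mono) auto
    finally show "\<bar>log_gauss' v\<bar> \<le> ?A * exp (- 2 * v)" .
  qed (use A in auto)
qed

text \<open>One integrable majorant for all \<open>u \<ge> w\<close>, as differentiation under the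
  integral demands. The factor \<open>h\<close> may grow like \<open>exp (- v)\<close> at minus
  infinity; decay of order 2 in the kernel outweighs this, and boundedness suffices on the other
  side. The two forms serve derivatives falling on the kernel and on \<open>h\<close>.\<close>

lemma kernel_dominated:
  fixes h :: "real \<Rightarrow> real"
  assumes f: "\<And>v. \<bar>f v\<bar> \<le> A" "\<And>v. \<bar>f v\<bar> \<le> A * exp (- 2 * v)"
    and h: "\<And>v. \<bar>h v\<bar> \<le> B * exp (- v)"
    and u: "w \<le> u"
  shows "\<bar>f (u - a) * h a\<bar> \<le> A * B * max 1 (exp (- 2 * w)) * exp (- \<bar>a\<bar>)"
    and "\<bar>f a * h (u - a)\<bar> \<le> A * B * exp (- w) * exp (- \<bar>a\<bar>)"
proof -
  have A: "A \<ge> 0" using f(1)[of 0] by linarith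
  have B: "B \<ge> 0" using h[of 0] by simp
  show "\<bar>f (u - a) * h a\<bar> \<le> A * B * max 1 (exp (- 2 * w)) * exp (- \<bar>a\<bar>)"
  proof (cases "a \<ge> 0")
    case True
    have "\<bar>f (u - a) * h a\<bar> \<le> A * (B * exp (- a))"
      unfolding abs_mult using A by (intro mult_mono f h) auto
    also have "\<dots> \<le> A * B * max 1 (exp (- 2 * w)) * exp (- \<bar>a\<bar>)"
      using True A B mult_left_mono[of 1 "max 1 (exp (- 2 * w))" "A * B * exp (- a)"]
      by (simp add: mult_ac)
    finally show ?thesis .
  next
    case False
    have "\<bar>f (u - a) * h a\<bar> \<le> (A * exp (- 2 * (u - a))) * (B * exp (- a))"
      unfolding abs_mult using A by (intro mult_mono f h) auto
    also have "\<dots> = A * B * exp (- 2 * u) * exp (- \<bar>a\<bar>)"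
      using False by (simp add: exp_add[symmetric] algebra_simps)
    also have "\<dots> \<le> A * B * max 1 (exp (- 2 * w)) * exp (- \<bar>a\<bar>)"
      using u A B by (intro mult_right_mono mult_left_mono max.coboundedI2) auto
    finally show ?thesis .
  qed
  \<comment> \<open>\<open>exp (- a) * exp (- \<bar>a\<bar>)\<close> is the minimum of 1 and
    \<open>exp (- 2 * a)\<close>, so it merges both kernel bounds; its first factor cancels the
    growth of \<open>h (u - a)\<close> in \<open>a\<close>.\<close>
  have *: "\<bar>f a * h (u - a)\<bar> \<le> (A * (exp (-a) * exp (- \<bar>a\<bar>))) * (B * exp (- (u - a)))"
    unfolding abs_mult using A B f(1)[of a] f(2)[of a]
    by (intro mult_mono h) (auto simp: exp_add[symmetric] abs_if)
  also have "\<dots> = A * B * exp (- u) * exp (- \<bar>a\<bar>)"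
    by (simp add: exp_add[symmetric] algebra_simps)
  also have "\<dots> \<le> A * B * exp (- w) * exp (- \<bar>a\<bar>)"
    using u A B by (intro mult_right_mono mult_left_mono) auto
  finally show "\<bar>f a * h (u - a)\<bar> \<le> A * B * exp (- w) * exp (- \<bar>a\<bar>)" .
qed

text \<open>With \<open>y = exp u\<close> and \<open>s = exp a\<close> this is the multiplicative convolution
  \<open>\<integral> \<phi> (y / s) h(s) ds / s\<close> with the Gaussian density \<open>\<phi>\<close>.\<close>

definition mconv :: "(real \<Rightarrow> real) \<Rightarrow> real \<Rightarrow> real" where
  "mconv h u = (\<integral>a. log_gauss (u - a) * h a \<partial>lborel)"

text \<open>Reflecting the integration variable moves \<open>u\<close> from the kernel into
  \<open>h\<close>, so that either factor can take the derivative.\<close>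

lemma mconv_swap: "mconv h u = (\<integral>a. log_gauss a * h (u - a) \<partial>lborel)"
  unfolding mconv_def
  by (subst lborel_integral_real_affine[where c = "-1" and t = u]) (simp_all add: algebra_simps)

lemma log_gauss_abs [simp]: "\<bar>log_gauss v\<bar> = log_gauss v"
  using log_gauss_pos[of v] by simp

lemma tame_bound1:
  assumes "tame h" obtains B where "B > 0" "\<And>v. \<bar>h v\<bar> \<le> B * exp (- v)"
proof -
  from assms obtain C where "C > 0" "\<forall>a. \<bar>h a\<bar> \<le> C * exp (- real 1 * a)"
    unfolding tame_def by blast
  then show ?thesis by (intro that[of C]) auto
qed

lemma mconv_integrable:
  assumes "tame h"
  shows "integrable lborel (\<lambda>a. log_gauss (u - a) * h a)"
    and "integrable lborel (\<lambda>a. log_gauss a * h (u - a))"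
proof -
  have [measurable]: "h \<in> borel_measurable borel" using assms by (rule tame_measurable)
  obtain B where B: "B > 0" "\<And>v. \<bar>h v\<bar> \<le> B * exp (- v)"
    using assms by (rule tame_bound1) blast
  obtain A where A: "A > 0" "\<And>v. log_gauss v \<le> A" "\<And>v. log_gauss v \<le> A * exp (- 2 * v)"
    using kernel_bounds by metis
  note d = kernel_dominated[of log_gauss A h B u u, simplified, OF A(2) A(3)[simplified] B(2)]
  show "integrable lborel (\<lambda>a. log_gauss (u - a) * h a)"
    by (rule Bochner_Integration.integrable_bound[OF integrable_mult_right[OF integrable_exp_minus_abs,
          of "A * B * max 1 (exp (- 2 * u))"]])
       (use d(1) in \<open>auto intro!: AE_I2 intro: order_trans[OF _ abs_ge_self]\<close>)
  show "integrable lborel (\<lambda>a. log_gauss a * h (u - a))"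
    by (rule Bochner_Integration.integrable_bound[OF integrable_mult_right[OF integrable_exp_minus_abs,
          of "A * B * exp (- u)"]])
       (use d(2) in \<open>auto intro!: AE_I2 intro: order_trans[OF _ abs_ge_self]\<close>)
qed

text \<open>The bound on \<open>h (u - a)\<close> splits into \<open>exp (- k * u)\<close> and
  \<open>exp (k * a)\<close>, which leaves an exponential moment of
  \<open>log_gauss\<close>.\<close>

lemma tame_mconv:
  assumes "tame h" shows "tame (mconv h)"
  unfolding tame_def
proof (intro conjI allI impI)
  have [measurable]: "h \<in> borel_measurable borel" using assms by (rule tame_measurable)
  show "mconv h \<in> borel_measurable borel" unfolding mconv_def by measurable
  fix k :: nat assume k: "1 \<le> k"
  then obtain B where B: "B > 0" "\<And>a. \<bar>h a\<bar> \<le> B * exp (- real k * a)"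
    using assms unfolding tame_def by blast
  have int: "integrable lborel (\<lambda>a. log_gauss a * exp (real k * a))"
  proof -
    obtain C where C: "C > 0" "\<And>v. log_gauss v \<le> C * exp (- real 0 * v)"
       using log_gauss_le_exp[of 0] by metis
    obtain D where D: "D > 0" "\<And>v. log_gauss v \<le> D * exp (- real (k + 1) * v)"
       using log_gauss_le_exp[of "k + 1"] by metis
    \<comment> \<open>For \<open>a \<ge> 0\<close>, decay of order \<open>k + 1\<close> leaves
      \<open>exp (- a)\<close>. For \<open>a < 0\<close>, boundedness is enough because
      \<open>k \<ge> 1\<close> gives \<open>exp (k * a) \<le> exp a\<close>.\<close>
    have "log_gauss a * exp (real k * a) \<le> (C + D) * exp (- \<bar>a\<bar>)" for a
    proof (cases "a \<ge> 0")
      case True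
      have "log_gauss a * exp (real k * a) \<le> (D * exp (- real (k + 1) * a)) * exp (real k * a)"
        by (intro mult_right_mono D) auto
      also have "\<dots> = D * exp (- \<bar>a\<bar>)" using True by (simp add: exp_add[symmetric] algebra_simps)
      also have "\<dots> \<le> (C + D) * exp (- \<bar>a\<bar>)" using C(1) by (intro mult_right_mono) auto
      finally show ?thesis .
    next
      case False
      have "log_gauss a * exp (real k * a) \<le> C * exp (- \<bar>a\<bar>)"
        using C(2)[of a] k False C(1) mult_right_mono_neg[of 1 "real k" a]
        by (intro mult_mono) (auto simp: log_gauss_pos less_imp_le)
      also have "\<dots> \<le> (C + D) * exp (- \<bar>a\<bar>)" using D(1) by (intro mult_right_mono) auto
      finally show ?thesis .
    qed
    then show ?thesis
      by (intro Bochner_Integration.integrable_bound[OF integrable_mult_right[OF integrable_exp_minus_abs,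
          of "C + D"]]) (auto intro!: AE_I2 simp: abs_mult order_trans[OF _ mult_right_mono[OF abs_ge_self]])
  qed
  let ?I = "\<integral>a. log_gauss a * exp (real k * a) \<partial>lborel"
  \<comment> \<open>The added 1 makes the constant strictly positive once \<open>?I \<ge> 0\<close>
    is known.\<close>
  have "\<bar>mconv h u\<bar> \<le> (B * (?I + 1)) * exp (- real k * u)" for u
  proof -
    have "\<bar>mconv h u\<bar> \<le> (\<integral>a. \<bar>log_gauss a * h (u - a)\<bar> \<partial>lborel)"
      unfolding mconv_swap by (rule integral_abs_bound)
    also have "\<dots> \<le> (\<integral>a. (B * exp (- real k * u)) * (log_gauss a * exp (real k * a)) \<partial>lborel)"
    proof (rule integral_mono)
      show "integrable lborel (\<lambda>a. \<bar>log_gauss a * h (u - a)\<bar>)"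
        using mconv_integrable(2)[OF assms] by (rule integrable_abs)
      show "integrable lborel (\<lambda>a. (B * exp (- real k * u)) * (log_gauss a * exp (real k * a)))"
        using int by (rule integrable_mult_right)
      fix a
      have "\<bar>log_gauss a * h (u - a)\<bar> \<le> log_gauss a * (B * exp (- real k * (u - a)))"
        unfolding abs_mult log_gauss_abs by (intro mult_left_mono B less_imp_le log_gauss_pos)
      then show "\<bar>log_gauss a * h (u - a)\<bar> \<le> (B * exp (- real k * u)) * (log_gauss a * exp (real k * a))"
        by (simp add: exp_add[symmetric] algebra_simps)
    qed
    also have "\<dots> = B * ?I * exp (- real k * u)" by simp
    also have "\<dots> \<le> (B * (?I + 1)) * exp (- real k * u)"
      using B(1) by (intro mult_right_mono mult_left_mono) auto
    finally show ?thesis .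
  qed
  moreover have "?I \<ge> 0" by (intro integral_nonneg_AE) (auto simp: log_gauss_pos less_imp_le)
  ultimately show "\<exists>C>0. \<forall>a. \<bar>mconv h a\<bar> \<le> C * exp (- real k * a)"
    using B(1) by (intro exI[of _ "B * (?I + 1)"]) auto
qed

lemma mconv_nonneg: "(\<And>a. 0 \<le> h a) \<Longrightarrow> 0 \<le> mconv h u"
  unfolding mconv_def by (intro integral_nonneg_AE) (auto simp: log_gauss_pos less_imp_le)

lemma mconv_deriv_arg:
  assumes "tame h" "tame h'" "\<And>u. (h has_real_derivative h' u) (at u)"
  shows "(mconv h has_real_derivative mconv h' u) (at u)"
proof -
  have [measurable]: "h' \<in> borel_measurable borel" using assms by (intro tame_measurable)
  obtain B where B: "B > 0" "\<And>v. \<bar>h' v\<bar> \<le> B * exp (- v)"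
    using assms(2) by (rule tame_bound1) blast
  obtain A where A: "A > 0" "\<And>v. log_gauss v \<le> A" "\<And>v. log_gauss v \<le> A * exp (- 2 * v)"
    using kernel_bounds by metis
  show ?thesis
    unfolding mconv_swap[abs_def]
  \<comment> \<open>The majorant is uniform only on right half-lines; any left end below
    \<open>u\<close> would serve.\<close>
  proof (rule has_real_derivative_integral_dominated[where S = "{u - 1<..}"
        and g = "\<lambda>a. A * B * exp (- (u - 1)) * exp (- \<bar>a\<bar>)"])
    show "integrable lborel (\<lambda>a. log_gauss a * h (v - a))" for v
      by (rule mconv_integrable) fact
    show "((\<lambda>v. log_gauss a * h (v - a)) has_real_derivative log_gauss a * h' (v - a)) (at v)" for v a
      by (auto intro!: derivative_eq_intros DERIV_chain'[OF _ assms(3)])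
    show "\<bar>log_gauss a * h' (v - a)\<bar> \<le> A * B * exp (- (u - 1)) * exp (- \<bar>a\<bar>)" if "v \<in> {u - 1<..}" for v a
      using that A B by (intro kernel_dominated(2)) auto
  qed (auto intro: integrable_exp_minus_abs)
qed

text \<open>Here the derivative falls on the kernel and yields \<open>- exp (2 * (u - a))\<close>.
  The weight \<open>exp (2 * a)\<close> completes this to \<open>- exp (2 * u)\<close>, which leaves
  the integral.\<close>

lemma mconv_deriv_kernel:
  assumes "tame h"
  shows "(mconv (\<lambda>a. exp (2 * a) * h a) has_real_derivative - exp (2 * u) * mconv h u) (at u)"
proof -
  let ?g = "\<lambda>a. exp (2 * a) * h a"
  have g: "tame ?g" using tame_exp_mult[OF assms, of 2] by simp
  have [measurable]: "h \<in> borel_measurable borel" using assms by (intro tame_measurable)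
  obtain B where B: "B > 0" "\<And>v. \<bar>?g v\<bar> \<le> B * exp (- v)"
    using g by (rule tame_bound1) blast
  obtain A where A: "A > 0" "\<And>v. \<bar>log_gauss' v\<bar> \<le> A" "\<And>v. \<bar>log_gauss' v\<bar> \<le> A * exp (- 2 * v)"
    using kernel_bounds by metis
  have [measurable]: "log_gauss' \<in> borel_measurable borel"
    by (intro tame_measurable tame_log_gauss')
  have "(mconv ?g has_real_derivative (\<integral>a. log_gauss' (u - a) * ?g a \<partial>lborel)) (at u)"
    unfolding mconv_def[abs_def]
  proof (rule has_real_derivative_integral_dominated[where S = "{u - 1<..}"
        and g = "\<lambda>a. A * B * max 1 (exp (- 2 * (u - 1))) * exp (- \<bar>a\<bar>)"])
    show "integrable lborel (\<lambda>a. log_gauss (v - a) * ?g a)" for v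
      by (rule mconv_integrable[OF g])
    show "((\<lambda>v. log_gauss (v - a) * ?g a) has_real_derivative log_gauss' (v - a) * ?g a) (at v)" for v a
      by (auto intro!: derivative_eq_intros DERIV_chain'[OF _ log_gauss_deriv])
    show "\<bar>log_gauss' (v - a) * ?g a\<bar> \<le> A * B * max 1 (exp (- 2 * (u - 1))) * exp (- \<bar>a\<bar>)"
      if "v \<in> {u - 1<..}" for v a
      using that A B by (intro kernel_dominated(1)) auto
  qed (auto intro: integrable_exp_minus_abs)
  also have "(\<integral>a. log_gauss' (u - a) * ?g a \<partial>lborel) = (\<integral>a. - exp (2 * u) * (log_gauss (u - a) * h a) \<partial>lborel)"
    by (intro Bochner_Integration.integral_cong refl)
       (simp add: log_gauss'_def right_diff_distrib exp_diff)
  also have "\<dots> = - exp (2 * u) * mconv h u"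
    unfolding mconv_def by (rule integral_mult_right_zero)
  finally show ?thesis .
qed

section \<open>The third-order equation of the threefold convolution\<close>

lemma mconv_uminus: "mconv (\<lambda>a. - h a) u = - mconv h u"
  by (simp add: mconv_def)

text \<open>These are G, G' and G'' of the overview. The first derivative falls on the innermost
  Gaussian, the second on the middle one; a third, on the outer kernel, leads back to G with the
  factor \<open>- exp (2 * u)\<close>.\<close>

abbreviation "mconv2 \<equiv> mconv (mconv log_gauss)"

abbreviation "mconv2' \<equiv> mconv (mconv log_gauss')"

abbreviation "mconv2'' \<equiv> mconv (\<lambda>a. exp (2 * a) * mconv log_gauss a)"

text \<open>Together these say that the second derivative is \<open>exp (2 * u)\<close> times the
  function, which is the Bessel equation of order 0 in the variable \<open>exp u\<close>.\<close>

lemma mconv_log_gauss_deriv: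
  "(mconv log_gauss has_real_derivative mconv log_gauss' u) (at u)"
  "(mconv log_gauss' has_real_derivative exp (2 * u) * mconv log_gauss u) (at u)"
proof -
  show "(mconv log_gauss has_real_derivative mconv log_gauss' u) (at u)"
    by (intro mconv_deriv_arg tame_log_gauss tame_log_gauss' log_gauss_deriv)
  have "log_gauss' = (\<lambda>a. exp (2 * a) * (- log_gauss a))"
    by (auto simp: log_gauss'_def)
  with mconv_deriv_kernel[OF tame_uminus[OF tame_log_gauss], of u]
  show "(mconv log_gauss' has_real_derivative exp (2 * u) * mconv log_gauss u) (at u)"
    by (simp add: mconv_uminus)
qed

lemma mconv2_deriv:
  "(mconv2 has_real_derivative mconv2' u) (at u)"
  "(mconv2' has_real_derivative mconv2'' u) (at u)"
  "(mconv2'' has_real_derivative - exp (2 * u) * mconv2 u) (at u)"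
  using tame_exp_mult[OF tame_mconv[OF tame_log_gauss], of 2]
  by (intro mconv_deriv_arg mconv_deriv_kernel mconv_log_gauss_deriv tame_mconv tame_log_gauss
      tame_log_gauss'; simp)+

section \<open>The density and its differential equation\<close>

text \<open>The substitution is made on compact intervals that exhaust the line, and monotone
  convergence passes to the limit on both sides. \<open>Suc n\<close> keeps each interval
  nondegenerate.\<close>

lemma nn_integral_exp_substitution:
  fixes f :: "real \<Rightarrow> ennreal"
  assumes [measurable]: "f \<in> borel_measurable borel"
  shows "(\<integral>\<^sup>+s\<in>{0<..}. f s \<partial>lborel) = (\<integral>\<^sup>+a. f (exp a) * ennreal (exp a) \<partial>lborel)"
proof -
  have "(\<integral>\<^sup>+s. f s * indicator {0<..} s \<partial>lborel) =
      (\<integral>\<^sup>+s. (SUP n. f s * indicator {exp (- real (Suc n))..exp (real (Suc n))} s) \<partial>lborel)"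
  proof (intro nn_integral_cong antisym)
    fix s :: real
    show "f s * indicator {0<..} s \<le> (SUP n. f s * indicator {exp (- real (Suc n))..exp (real (Suc n))} s)"
    proof (cases "s > 0")
      case True
      obtain n where "\<bar>ln s\<bar> \<le> real n" using real_arch_simple by blast
      then have "s \<in> {exp (- real (Suc n))..exp (real (Suc n))}"
        using True exp_le_cancel_iff[of "- real (Suc n)" "ln s"] exp_le_cancel_iff[of "ln s" "real (Suc n)"]
        by (auto simp: abs_le_iff simp del: exp_le_cancel_iff)
      then show ?thesis using True by (intro SUP_upper2[of n]) auto
    qed simp
    show "(SUP n. f s * indicator {exp (- real (Suc n))..exp (real (Suc n))} s) \<le> f s * indicator {0<..} s"
      by (intro SUP_least) (auto split: split_indicator intro: less_le_trans[OF exp_gt_zero])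
  qed
  also have "\<dots> = (SUP n. \<integral>\<^sup>+s. f s * indicator {exp (- real (Suc n))..exp (real (Suc n))} s \<partial>lborel)"
  proof (intro nn_integral_monotone_convergence_SUP incseq_SucI le_funI)
    fix n and s :: real
    have mono: "A \<subseteq> B \<Longrightarrow> f s * indicator A s \<le> f s * indicator B s" for A B
      by (auto split: split_indicator)
    have "{exp (- real (Suc n))..exp (real (Suc n))} \<subseteq> {exp (- real (Suc (Suc n)))..exp (real (Suc (Suc n)))}"
      by (simp add: atLeastatMost_subset_iff)
    then show "f s * indicator {exp (- real (Suc n))..exp (real (Suc n))} s \<le>
        f s * indicator {exp (- real (Suc (Suc n)))..exp (real (Suc (Suc n)))} s"
      by (rule mono)
  qed measurable
  also have "\<dots> = (SUP n. \<integral>\<^sup>+a. f (exp a) * ennreal (exp a) * indicator {- real (Suc n)..real (Suc n)} a \<partial>lborel)"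
    by (intro SUP_cong refl nn_integral_substitution_aux)
       (auto intro!: derivative_eq_intros continuous_intros)
  also have "\<dots> = (\<integral>\<^sup>+a. (SUP n. f (exp a) * ennreal (exp a) * indicator {- real (Suc n)..real (Suc n)} a) \<partial>lborel)"
    by (intro nn_integral_monotone_convergence_SUP[symmetric])
       (auto simp: incseq_def le_fun_def split: split_indicator)
  also have "\<dots> = (\<integral>\<^sup>+a. f (exp a) * ennreal (exp a) \<partial>lborel)"
  proof (intro nn_integral_cong antisym)
    fix a :: real
    obtain n where "\<bar>a\<bar> \<le> real n" using real_arch_simple by blast
    then show "f (exp a) * ennreal (exp a) \<le> (SUP n. f (exp a) * ennreal (exp a) * indicator {- real (Suc n)..real (Suc n)} a)"
      by (intro SUP_upper2[of n]) (auto simp: abs_le_iff)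
    show "(SUP n. f (exp a) * ennreal (exp a) * indicator {- real (Suc n)..real (Suc n)} a) \<le> f (exp a) * ennreal (exp a)"
      by (intro SUP_least) (auto split: split_indicator)
  qed
  finally show ?thesis .
qed

text \<open>This links the extended integrals to the real function \<open>mconv\<close> and shows
  them finite. The shift \<open>l\<close> absorbs the time scale, and later the normalisation of the
  Bessel integral.\<close>

lemma nn_integral_mconv:
  assumes h: "tame h" "\<And>a. 0 \<le> h a" and c: "0 \<le> c"
  shows "(\<integral>\<^sup>+a. ennreal (c * (log_gauss (u - a) * h (a - l))) \<partial>lborel) = ennreal (c * mconv h (u - l))"
proof -
  have int: "integrable lborel (\<lambda>a. log_gauss (u - l - a) * h a)"
    using mconv_integrable(1)[OF h(1)] .
  have [measurable]: "h \<in> borel_measurable borel" using h(1) by (rule tame_measurable)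
  have "(\<integral>\<^sup>+a. ennreal (c * (log_gauss (u - a) * h (a - l))) \<partial>lborel) =
      (\<integral>\<^sup>+a. ennreal (c * (log_gauss (u - l - a) * h a)) \<partial>lborel)"
    by (subst nn_integral_real_affine[where c = 1 and t = l]) (auto simp: algebra_simps)
  also have "\<dots> = ennreal (\<integral>a. c * (log_gauss (u - l - a) * h a) \<partial>lborel)"
    using int h(2) c by (intro nn_integral_eq_integral) (auto intro!: AE_I2 mult_nonneg_nonneg log_gauss_pos[THEN less_imp_le])
  also have "\<dots> = ennreal (c * mconv h (u - l))"
    by (simp add: mconv_def)
  finally show ?thesis .
qed

lemma gauss_kernel_eq_log_gauss:
  fixes s z :: real
  assumes "z > 0" "s \<noteq> 0"
  shows "exp (- (s\<^sup>2 / (2 * z\<^sup>2))) / sqrt (2 * pi * z\<^sup>2) = log_gauss (ln \<bar>s\<bar> - ln z) / z"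
  using assms by (simp add: log_gauss_def exp_diff power_divide real_sqrt_mult field_simps)

lemma inner_integral:
  fixes s T :: real
  assumes "s > 0" "T > 0"
  shows "(\<integral>\<^sup>+z\<in>{0<..}. ennreal (exp (- (s\<^sup>2 / (2 * z\<^sup>2))) / sqrt (2 * pi * z\<^sup>2)) *
            ennreal (exp (- (z\<^sup>2 / (2 * T\<^sup>2))) / sqrt (2 * pi * T\<^sup>2)) \<partial>lborel) =
         ennreal (1 / T * mconv log_gauss (ln s - ln T))"
proof -
  have "(\<integral>\<^sup>+z\<in>{0<..}. ennreal (exp (- (s\<^sup>2 / (2 * z\<^sup>2))) / sqrt (2 * pi * z\<^sup>2)) *
            ennreal (exp (- (z\<^sup>2 / (2 * T\<^sup>2))) / sqrt (2 * pi * T\<^sup>2)) \<partial>lborel) =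
      (\<integral>\<^sup>+a. ennreal (1 / T * (log_gauss (ln s - a) * log_gauss (a - ln T))) \<partial>lborel)"
    using assms
    by (subst nn_integral_exp_substitution)
       (auto intro!: nn_integral_cong simp: gauss_kernel_eq_log_gauss ennreal_mult'[symmetric]
          log_gauss_pos less_imp_le)
  also have "\<dots> = ennreal (1 / T * mconv log_gauss (ln s - ln T))"
    using assms by (intro nn_integral_mconv tame_log_gauss) (auto simp: log_gauss_pos less_imp_le)
  finally show ?thesis .
qed

lemma bessel_K0_eq_mconv:
  assumes "r > 0"
  shows "bessel_K0 r = 2 * pi * mconv log_gauss (ln r)"
proof -
  \<comment> \<open>For a nonnegative integrand this holds whether or not the integral is finite;
    finiteness emerges from \<open>nn_integral_mconv\<close>.\<close>
  have "bessel_K0 r = enn2real (\<integral>\<^sup>+s. ennreal (indicator {0<..} s *\<^sub>R (1 / s * exp (- (r\<^sup>2 / (4 * s\<^sup>2)) - s\<^sup>2))) \<partial>lborel)"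
    unfolding bessel_K0_def set_lebesgue_integral_def
    by (intro integral_eq_nn_integral) (auto split: split_indicator)
  also have "(\<integral>\<^sup>+s. ennreal (indicator {0<..} s *\<^sub>R (1 / s * exp (- (r\<^sup>2 / (4 * s\<^sup>2)) - s\<^sup>2))) \<partial>lborel) =
      (\<integral>\<^sup>+s\<in>{0<..}. ennreal (1 / s * exp (- (r\<^sup>2 / (4 * s\<^sup>2)) - s\<^sup>2)) \<partial>lborel)"
    by (intro nn_integral_cong) (auto split: split_indicator)
  also have "\<dots> = (\<integral>\<^sup>+a. ennreal (exp (- (r\<^sup>2 / (4 * (exp a)\<^sup>2)) - (exp a)\<^sup>2)) \<partial>lborel)"
    by (subst nn_integral_exp_substitution) (auto intro!: nn_integral_cong simp: ennreal_mult'[symmetric])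
  \<comment> \<open>Rescaling \<open>exp a\<close> by the square root of 2 turns both exponents into
    halves of squares. The two shifts by \<open>ln 2 / 2\<close> cancel in \<open>ln r\<close>, and
    \<open>2 * pi\<close> undoes the two Gaussian normalisations.\<close>
  also have "\<dots> = (\<integral>\<^sup>+a. ennreal (2 * pi * (log_gauss (ln r - ln 2 / 2 - a) * log_gauss (a - (- ln 2 / 2)))) \<partial>lborel)"
  proof (intro nn_integral_cong arg_cong[where f = ennreal])
    fix a :: real
    have [simp]: "(exp (ln 2 / 2))\<^sup>2 = (2::real)"
      by (simp add: power2_eq_square exp_add[symmetric])
    have "2 * pi * (log_gauss (ln r - ln 2 / 2 - a) * log_gauss (a - (- ln 2 / 2))) =
      exp (- ((exp (ln r - ln 2 / 2 - a))\<^sup>2 / 2) - (exp (a + ln 2 / 2))\<^sup>2 / 2)"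
      by (simp add: log_gauss_def mult_exp_exp)
    also have "(exp (ln r - ln 2 / 2 - a))\<^sup>2 / 2 = r\<^sup>2 / (4 * (exp a)\<^sup>2)"
      using assms by (simp add: exp_diff power_divide power_mult_distrib)
    also have "(exp (a + ln 2 / 2))\<^sup>2 / 2 = (exp a)\<^sup>2"
      by (simp add: exp_add power_mult_distrib)
    finally show "exp (- (r\<^sup>2 / (4 * (exp a)\<^sup>2)) - (exp a)\<^sup>2) =
        2 * pi * (log_gauss (ln r - ln 2 / 2 - a) * log_gauss (a - (- ln 2 / 2)))" ..
  qed
  also have "\<dots> = ennreal (2 * pi * mconv log_gauss (ln r))"
    by (subst nn_integral_mconv) (auto simp: tame_log_gauss log_gauss_pos less_imp_le)
  finally show ?thesis
    by (simp add: mconv_nonneg log_gauss_pos less_imp_le)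
qed

text \<open>Valid at \<open>x = 0\<close> as well, hence a common start for the Bessel form and for
  the closed form away from 0.\<close>

lemma p2_inner:
  assumes "t > 0"
  shows "p2 H x t = 4 * (\<integral>\<^sup>+ s\<in>{0<..}. ennreal (exp (- (x\<^sup>2 / (2 * s\<^sup>2))) / sqrt (2 * pi * s\<^sup>2)) *
     ennreal (1 / t powr H * mconv log_gauss (ln s - ln (t powr H))) \<partial>lborel)"
proof -
  have "t powr H > 0" using assms by simp
  then show ?thesis
    unfolding p2_def powr_2H[OF assms]
    by (intro arg_cong[where f = "(*) 4"] nn_integral_cong)
       (auto simp: inner_integral split: split_indicator)
qed

lemma p2_eq_bessel:
  assumes "t > 0"
  shows "p2 H x t = 2 * (\<integral>\<^sup>+ s\<in>{0<..}.
              ennreal (exp (- (x\<^sup>2 / (2 * s\<^sup>2))) / sqrt (2 * pi * s\<^sup>2)) *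
              ennreal (1 / (pi * t powr H) * bessel_K0 (s / t powr H)) \<partial>lborel)"
proof -
  define T where "T = t powr H"
  have T: "T > 0" using assms by (simp add: T_def)
  have [measurable]: "mconv log_gauss \<in> borel_measurable borel"
    by (intro tame_measurable tame_mconv tame_log_gauss)
  have "(\<integral>\<^sup>+ s\<in>{0<..}. ennreal (exp (- (x\<^sup>2 / (2 * s\<^sup>2))) / sqrt (2 * pi * s\<^sup>2)) *
              ennreal (1 / (pi * T) * bessel_K0 (s / T)) \<partial>lborel) =
      (\<integral>\<^sup>+ s. 2 * (ennreal (exp (- (x\<^sup>2 / (2 * s\<^sup>2))) / sqrt (2 * pi * s\<^sup>2)) *
              ennreal (1 / T * mconv log_gauss (ln s - ln T)) * indicator {0<..} s) \<partial>lborel)"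
  proof (intro nn_integral_cong)
    fix s :: real
    show "ennreal (exp (- (x\<^sup>2 / (2 * s\<^sup>2))) / sqrt (2 * pi * s\<^sup>2)) *
        ennreal (1 / (pi * T) * bessel_K0 (s / T)) * indicator {0<..} s =
        2 * (ennreal (exp (- (x\<^sup>2 / (2 * s\<^sup>2))) / sqrt (2 * pi * s\<^sup>2)) *
        ennreal (1 / T * mconv log_gauss (ln s - ln T)) * indicator {0<..} s)"
    proof (cases "s > 0")
      case True
      \<comment> \<open>The 2 is the \<open>2 * pi\<close> of \<open>bessel_K0_eq_mconv\<close> over
        the \<open>pi\<close> here; it accounts for the leading 4 becoming 2.\<close>
      have "ennreal (1 / (pi * T) * bessel_K0 (s / T)) = 2 * ennreal (1 / T * mconv log_gauss (ln s - ln T))"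
        using True T by (simp add: bessel_K0_eq_mconv ln_div ennreal_mult'[symmetric]
           ennreal_numeral[symmetric] del: ennreal_numeral)
      then show ?thesis using True by (simp add: mult_ac)
    qed simp
  qed
  also have "\<dots> = 2 * (\<integral>\<^sup>+ s\<in>{0<..}. ennreal (exp (- (x\<^sup>2 / (2 * s\<^sup>2))) / sqrt (2 * pi * s\<^sup>2)) *
              ennreal (1 / T * mconv log_gauss (ln s - ln T)) \<partial>lborel)"
    by (rule nn_integral_cmult) measurable
  finally show ?thesis
    unfolding p2_inner[OF assms] T_def[symmetric] by (simp add: mult.assoc[symmetric])
qed

lemma p2_eq_mconv2:
  assumes "t > 0" "x \<noteq> 0"
  shows "p2 H x t = ennreal (4 / t powr H * mconv2 (ln \<bar>x\<bar> - H * ln t))"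
proof -
  define T where "T = t powr H"
  have T: "T > 0" "ln T = H * ln t" using assms by (simp_all add: T_def ln_powr)
  have [measurable]: "mconv log_gauss \<in> borel_measurable borel"
    by (intro tame_measurable tame_mconv tame_log_gauss)
  have nonneg: "0 \<le> mconv log_gauss a" for a by (simp add: mconv_nonneg log_gauss_pos less_imp_le)
  have "(\<integral>\<^sup>+ s\<in>{0<..}. ennreal (exp (- (x\<^sup>2 / (2 * s\<^sup>2))) / sqrt (2 * pi * s\<^sup>2)) *
     ennreal (1 / T * mconv log_gauss (ln s - ln T)) \<partial>lborel) =
     (\<integral>\<^sup>+a. ennreal (1 / T * (log_gauss (ln \<bar>x\<bar> - a) * mconv log_gauss (a - ln T))) \<partial>lborel)"
    using assms(2) T(1)
    by (subst nn_integral_exp_substitution)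
       (auto intro!: nn_integral_cong simp: gauss_kernel_eq_log_gauss ennreal_mult'[symmetric] nonneg
          log_gauss_pos less_imp_le)
  also have "\<dots> = ennreal (1 / T * mconv2 (ln \<bar>x\<bar> - ln T))"
    using T nonneg by (intro nn_integral_mconv tame_mconv tame_log_gauss) auto
  finally show ?thesis
    unfolding p2_inner[OF assms(1)] T_def[symmetric] T(2)
    using T(1) by (simp add: ennreal_mult'[symmetric] ennreal_numeral[symmetric] del: ennreal_numeral)
qed

section \<open>The fourth-order partial differential equation\<close>

lemma deriv_funpow_eqI:
  fixes D :: "nat \<Rightarrow> real \<Rightarrow> real"
  assumes S: "open S" "y \<in> S"
    and f: "\<And>y. y \<in> S \<Longrightarrow> f y = D 0 y"
    and D: "\<And>k y. k < n \<Longrightarrow> y \<in> S \<Longrightarrow> (D k has_real_derivative D (Suc k) y) (at y)"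
  shows "k \<le> n \<Longrightarrow> (deriv ^^ k) f y = D k y"
    and "k < n \<Longrightarrow> ((deriv ^^ k) f has_real_derivative D (Suc k) y) (at y)"
proof -
  \<comment> \<open>Agreement on an open set carries over to the derivative at each of its points,
    so the iterated derivatives can be identified one by one.\<close>
  have step: "((deriv ^^ k) f has_real_derivative D (Suc k) y) (at y)"
    if "k < n" "y \<in> S" "\<And>y. y \<in> S \<Longrightarrow> (deriv ^^ k) f y = D k y" for k y
    using D[OF that(1,2)] S(1) that(2)
    by (rule has_field_derivative_transform_within_open) (simp add: that(3))
  have eq: "k \<le> n \<Longrightarrow> y \<in> S \<Longrightarrow> (deriv ^^ k) f y = D k y" for k y
  proof (induction k arbitrary: y)
    case (Suc k)
    then show ?case using step[of k y] by (auto intro: DERIV_imp_deriv)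
  qed (use f in auto)
  show "k \<le> n \<Longrightarrow> (deriv ^^ k) f y = D k y" using eq S by blast
  show "k < n \<Longrightarrow> ((deriv ^^ k) f has_real_derivative D (Suc k) y) (at y)"
    using step eq S by auto
qed

text \<open>The \<open>k\<close>-th derivative of \<open>c * mconv2 (ln \<bar>y\<bar> - L)\<close> for \<open>k \<le> 4\<close>, with the third derivative
  of \<open>mconv2\<close> eliminated by \<open>mconv2''' = - exp (2 * u) * mconv2\<close>.
  Writing \<open>ln \<bar>y\<bar>\<close> as \<open>ln (y\<^sup>2) / 2\<close> treats both signs of \<open>y\<close> at once.\<close>

definition "p2_dx c L k y =
  (let v = ln (y\<^sup>2) / 2 - L; G0 = mconv2 v; G1 = mconv2' v; G2 = mconv2'' v; E = exp (2 * v) in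
   c * (if k = 0 then G0 else if k = 1 then G1 / y else if k = 2 then (G2 - G1) / y ^ 2
     else if k = 3 then (2 * G1 - 3 * G2 - E * G0) / y ^ 3
     else (11 * G2 - 6 * G1 + E * (4 * G0 - G1)) / y ^ 4))"
  for c L y :: real and k :: nat

text \<open>By the third-order equation, \<open>g0\<close>, \<open>g1\<close>, \<open>g2\<close> and
  \<open>e\<close> form a system closed under differentiation up to the factor \<open>1 / y\<close>.
  Each case is then a quotient rule.\<close>

lemma p2_dx_deriv:
  assumes "y \<noteq> 0" "k < 4"
  shows "(p2_dx c L k has_real_derivative p2_dx c L (Suc k) y) (at y)"
proof -
  have v: "((\<lambda>y. ln (y\<^sup>2) / 2 - L) has_real_derivative 1 / y) (at y)"
  proof -
    have "0 < y * y" using assms(1) by (metis power2_eq_square zero_less_power2)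
    then show ?thesis by (auto intro!: derivative_eq_intros simp: power2_eq_square)
  qed
  define g0 where "g0 = (\<lambda>y. mconv2 (ln (y\<^sup>2) / 2 - L))"
  define g1 where "g1 = (\<lambda>y. mconv2' (ln (y\<^sup>2) / 2 - L))"
  define g2 where "g2 = (\<lambda>y. mconv2'' (ln (y\<^sup>2) / 2 - L))"
  define e where "e = (\<lambda>y. exp (2 * (ln (y\<^sup>2) / 2 - L)))"
  have d: "(g0 has_real_derivative g1 y * (1 / y)) (at y)" "(g1 has_real_derivative g2 y * (1 / y)) (at y)"
    "(g2 has_real_derivative - e y * g0 y * (1 / y)) (at y)"
    "(e has_real_derivative e y * (2 * (1 / y))) (at y)"
    using DERIV_chain2[OF mconv2_deriv(1) v] DERIV_chain2[OF mconv2_deriv(2) v]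
      DERIV_chain2[OF mconv2_deriv(3) v] DERIV_chain2[OF DERIV_exp DERIV_cmult[OF v, of 2]]
    unfolding g0_def g1_def g2_def e_def .
  have dx: "p2_dx c L k = (\<lambda>y. c * (if k = 0 then g0 y else if k = 1 then g1 y / y
      else if k = 2 then (g2 y - g1 y) / y ^ 2
      else if k = 3 then (2 * g1 y - 3 * g2 y - e y * g0 y) / y ^ 3
      else (11 * g2 y - 6 * g1 y + e y * (4 * g0 y - g1 y)) / y ^ 4))" for k
    by (simp add: p2_dx_def Let_def fun_eq_iff g0_def g1_def g2_def e_def)
  consider "k = 0" | "k = 1" | "k = 2" | "k = 3" using assms(2) by linarith
  then show ?thesis
    by cases (use assms(1) in \<open>auto intro!: derivative_eq_intros d
      simp: dx field_simps power2_eq_square power3_eq_cube power4_eq_xxxx\<close>)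
qed

lemma p2_pde:
  assumes "x \<noteq> 0" "t > 0"
  shows "p2 H x t < \<infinity> \<and>
       (let p = (\<lambda>x t. enn2real (p2 H x t));
            dx = (\<lambda>k. (deriv ^^ k) (\<lambda>y. p y t))
        in (\<forall>k<4. dx k differentiable (at x)) \<and>
           ((\<lambda>u. p x u) has_real_derivative
              H * t powr (2 * H - 1) *
                (4 * dx 2 x + 5 * x * dx 3 x + x\<^sup>2 * dx 4 x)) (at t))"
proof -
  define T where "T = t powr H"
  define L where "L = H * ln t"
  have T: "T > 0" using assms by (simp add: T_def)
  have TL: "T = exp L" using assms by (simp add: T_def L_def powr_def)
  have nonneg: "0 \<le> mconv2 v" for v
    by (intro mconv_nonneg log_gauss_pos[THEN less_imp_le])
  \<comment> \<open>Time enters only through \<open>H * ln u\<close>, so this one formula can be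
    differentiated in either variable.\<close>
  have real: "enn2real (p2 H y u) = 4 * exp (- H * ln u) * mconv2 (ln (y\<^sup>2) / 2 - H * ln u)"
    if "y \<noteq> 0" "u > 0" for y u
  proof -
    have ln: "ln \<bar>y\<bar> = ln (y\<^sup>2) / 2" using that ln_realpow[of "\<bar>y\<bar>" 2] by simp
    have powr: "4 / u powr H = 4 * exp (- H * ln u)"
      using that by (simp add: powr_def exp_minus divide_inverse)
    show ?thesis
      unfolding p2_eq_mconv2[OF that(2,1)] ln powr by (intro enn2real_ennreal mult_nonneg_nonneg nonneg) auto
  qed
  have D0: "enn2real (p2 H y t) = p2_dx (4 / T) L 0 y" if "y \<in> - {0}" for y
  proof -
    have e: "4 * exp (- H * ln t) = 4 / T"
      unfolding TL L_def by (simp add: exp_minus field_simps)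
    show ?thesis
      using real[of y t] that assms(2) unfolding e by (simp add: p2_dx_def Let_def L_def)
  qed
  note dfp = deriv_funpow_eqI[where S = "- {0}" and n = 4 and f = "\<lambda>y. enn2real (p2 H y t)" and y = x
      and D = "p2_dx (4 / T) L", OF _ _ D0 p2_dx_deriv]
  have dx: "(deriv ^^ k) (\<lambda>y. enn2real (p2 H y t)) x = p2_dx (4 / T) L k x" if "k \<le> 4" for k
    using assms that by (intro dfp(1)) auto
  have diff: "(deriv ^^ k) (\<lambda>y. enn2real (p2 H y t)) differentiable (at x)" if "k < 4" for k
  proof -
    have "((deriv ^^ k) (\<lambda>y. enn2real (p2 H y t)) has_real_derivative p2_dx (4 / T) L (Suc k) x) (at x)"
      using assms that by (intro dfp(2)) auto
    then show ?thesis unfolding real_differentiable_def by blast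
  qed
  define v where "v = ln (x\<^sup>2) / 2 - L"
  have E: "exp (2 * v) = x\<^sup>2 / T\<^sup>2"
    using assms unfolding v_def TL by (simp add: right_diff_distrib exp_diff exp_double)
  have dv: "((\<lambda>u. ln (x\<^sup>2) / 2 - H * ln u) has_real_derivative - (H / t)) (at t)"
    using assms by (auto intro!: derivative_eq_intros)
  have "((\<lambda>u. 4 * exp (- H * ln u)) has_real_derivative - (4 * H / (t * T))) (at t)"
    using assms unfolding TL L_def by (auto intro!: derivative_eq_intros simp: exp_minus field_simps)
  from DERIV_mult[OF this DERIV_chain2[OF mconv2_deriv(1) dv]]
  have "((\<lambda>u. 4 * exp (- H * ln u) * mconv2 (ln (x\<^sup>2) / 2 - H * ln u)) has_real_derivative
      - (4 * H / (t * T)) * (mconv2 v + mconv2' v)) (at t)"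
    by (rule DERIV_cong) (use assms in \<open>simp add: v_def TL L_def exp_minus field_simps\<close>)
  then have "((\<lambda>u. enn2real (p2 H x u)) has_real_derivative
      - (4 * H / (t * T)) * (mconv2 v + mconv2' v)) (at t)"
    by (rule has_field_derivative_transform_within_open[where S = "{0<..}"]) (use assms real in auto)
  \<comment> \<open>Multiplied by \<open>x ^ 2\<close>, the bracket with weights 4, 5, 1 loses its
    \<open>mconv2'' v\<close> terms (4 - 15 + 11 = 0) and its unweighted \<open>mconv2' v\<close>
    terms (-4 + 10 - 6 = 0). What remains is \<open>- exp (2 * v) * (mconv2 v + mconv2' v)\<close>
    times \<open>4 / T\<close>, and \<open>exp (2 * v) = x ^ 2 / T ^ 2\<close> matches the time
    derivative.\<close>
  also have "- (4 * H / (t * T)) * (mconv2 v + mconv2' v) = H * t powr (2 * H - 1) *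
      (4 * p2_dx (4 / T) L 2 x + 5 * x * p2_dx (4 / T) L 3 x + x\<^sup>2 * p2_dx (4 / T) L 4 x)"
  proof -
    have "t powr (2 * H - 1) = T\<^sup>2 / t"
      using assms by (simp add: powr_diff powr_2H T_def)
    then show ?thesis
      using assms T
      by (simp add: p2_dx_def Let_def v_def[symmetric] E)
         (simp add: field_simps power2_eq_square power3_eq_cube power4_eq_xxxx)
  qed
  finally show ?thesis
    using diff by (simp add: Let_def dx p2_eq_mconv2[OF assms(2,1)])
qed

section \<open>Processes evaluated at independent random times\<close>

text \<open>Point evaluation \<open>(p, r) \<mapsto> p r\<close> is not measurable for the cylinder \<open>\<sigma>\<close>-algebra; this limit over
  countably many evaluation times is, and it agrees with evaluation on continuous paths.\<close>

definition path_eval :: "(real \<Rightarrow> real) \<Rightarrow> real \<Rightarrow> real" where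
  "path_eval p r = lim (\<lambda>n. p (real (nat \<lfloor>real (Suc n) * r\<rfloor>) / real (Suc n)))"

text \<open>The sampled times differ from \<open>r\<close> by at most \<open>1 / (n + 1)\<close> and
  stay in the half-line, where continuity is available.\<close>

lemma path_eval_eq:
  assumes "continuous_on {0..} p" "0 \<le> r"
  shows "path_eval p r = p r"
proof -
  let ?q = "\<lambda>n. real (nat \<lfloor>real (Suc n) * r\<rfloor>) / real (Suc n)"
  have "(\<lambda>n. ?q n - r) \<longlonglongrightarrow> 0"
  proof (rule Lim_null_comparison)
    show "(\<lambda>n. inverse (real (Suc n))) \<longlonglongrightarrow> 0" by (rule LIMSEQ_inverse_real_of_nat)
    show "\<forall>\<^sub>F n in sequentially. norm (?q n - r) \<le> inverse (real (Suc n))"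
    proof (intro always_eventually allI)
      fix n
      have "norm (?q n - r) = \<bar>of_int \<lfloor>real (Suc n) * r\<rfloor> - real (Suc n) * r\<bar> / real (Suc n)"
        using assms(2) by (simp add: abs_if field_simps del: of_nat_Suc)
      also have "\<dots> \<le> 1 / real (Suc n)"
        by (intro divide_right_mono) (auto simp: abs_le_iff del: of_nat_Suc, linarith+)
      finally show "norm (?q n - r) \<le> inverse (real (Suc n))" by (simp add: inverse_eq_divide)
    qed
  qed
  then have "?q \<longlonglongrightarrow> r" by (simp add: LIM_zero_iff)
  then have "(\<lambda>n. p (?q n)) \<longlonglongrightarrow> p r"
    using assms by (intro continuous_on_tendsto_compose[OF assms(1)]) auto
  then show ?thesis unfolding path_eval_def by (rule limI)
qed

abbreviation path_space :: "(real \<Rightarrow> real) measure" where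
  "path_space \<equiv> PiM {0..} (\<lambda>_. borel)"

text \<open>For fixed \<open>n\<close> the time takes countably many values, and for each of them
  evaluation is a coordinate projection.\<close>

lemma path_eval_measurable [measurable (raw)]:
  assumes p [measurable]: "p \<in> measurable M path_space" and r [measurable]: "r \<in> borel_measurable M"
  shows "(\<lambda>x. path_eval (p x) (r x)) \<in> borel_measurable M"
  unfolding path_eval_def
proof (rule borel_measurable_lim_metric)
  fix n
  show "(\<lambda>x. p x (real (nat \<lfloor>real (Suc n) * r x\<rfloor>) / real (Suc n))) \<in> borel_measurable M"
  proof (rule measurable_compose_countable[where f = "\<lambda>i x. p x (real i / real (Suc n))"])
    show "(\<lambda>x. p x (real i / real (Suc n))) \<in> borel_measurable M" for i
      using measurable_compose[OF p measurable_component_singleton[of "real i / real (Suc n)" "{0..}" "\<lambda>_. borel"]]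
      by (simp del: of_nat_Suc)
  qed measurable
qed

text \<open>The library's \<open>indep_var\<close> requires both variables to have the same value type.\<close>

definition indep_rv_pair ::
    "'a measure \<Rightarrow> 'b measure \<Rightarrow> ('a \<Rightarrow> 'b) \<Rightarrow> 'c measure \<Rightarrow> ('a \<Rightarrow> 'c) \<Rightarrow> bool" where
  "indep_rv_pair M S X T Y \<longleftrightarrow> X \<in> measurable M S \<and> Y \<in> measurable M T \<and>
     distr M S X \<Otimes>\<^sub>M distr M T Y = distr M (S \<Otimes>\<^sub>M T) (\<lambda>\<omega>. (X \<omega>, Y \<omega>))"

section \<open>Independent pairs and Gaussian mixtures\<close>

context prob_space
begin

lemma indep_rv_pair_compose:
  assumes ind: "indep_rv_pair M S X T Y"
    and f [measurable]: "f \<in> measurable S S'" and g [measurable]: "g \<in> measurable T T'"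
  shows "indep_rv_pair M S' (\<lambda>\<omega>. f (X \<omega>)) T' (\<lambda>\<omega>. g (Y \<omega>))"
proof -
  have X [measurable]: "X \<in> measurable M S" and Y [measurable]: "Y \<in> measurable M T"
    and eq: "distr M S X \<Otimes>\<^sub>M distr M T Y = distr M (S \<Otimes>\<^sub>M T) (\<lambda>\<omega>. (X \<omega>, Y \<omega>))"
    using ind by (auto simp: indep_rv_pair_def)
  interpret X: prob_space "distr M S X" by (rule prob_space_distr) (rule X)
  interpret Y: prob_space "distr M T Y" by (rule prob_space_distr) (rule Y)
  interpret Y': prob_space "distr (distr M T Y) T' g" by (rule Y.prob_space_distr) simp
  have "distr M S' (\<lambda>\<omega>. f (X \<omega>)) \<Otimes>\<^sub>M distr M T' (\<lambda>\<omega>. g (Y \<omega>)) =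
      distr (distr M S X) S' f \<Otimes>\<^sub>M distr (distr M T Y) T' g"
    by (simp add: distr_distr comp_def)
  also have "\<dots> = distr (distr M S X \<Otimes>\<^sub>M distr M T Y) (S' \<Otimes>\<^sub>M T') (\<lambda>(x, y). (f x, g y))"
    by (rule pair_measure_distr) (simp_all, unfold_locales)
  also have "\<dots> = distr M (S' \<Otimes>\<^sub>M T') (\<lambda>\<omega>. (f (X \<omega>), g (Y \<omega>)))"
    unfolding eq by (subst distr_distr) (auto simp: comp_def)
  finally show ?thesis
    unfolding indep_rv_pair_def by simp
qed

lemma indep_var_imp_indep_rv_pair: "indep_var S X T Y \<Longrightarrow> indep_rv_pair M S X T Y"
  by (simp add: indep_rv_pair_def indep_var_distribution_eq)

text \<open>Continuity allows evaluation to be replaced by the measurable \<open>path_eval\<close>.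
  The joint law of path and time is a product by independence, so Tonelli's theorem lets the path be
  integrated out with the time frozen.\<close>

lemma nn_integral_random_time:
  fixes B :: "real \<Rightarrow> 'a \<Rightarrow> real" and \<tau> :: "'a \<Rightarrow> real" and f :: "real \<Rightarrow> ennreal"
  assumes ind: "indep_rv_pair M path_space (\<lambda>\<omega>. \<lambda>t\<in>{0..}. B t \<omega>) borel \<tau>"
    and cont: "\<And>\<omega>. \<omega> \<in> space M \<Longrightarrow> continuous_on {0..} (\<lambda>t. B t \<omega>)"
    and nonneg: "\<And>\<omega>. \<omega> \<in> space M \<Longrightarrow> 0 \<le> \<tau> \<omega>"
    and f [measurable]: "f \<in> borel_measurable borel"
  shows "(\<lambda>\<omega>. B (\<tau> \<omega>) \<omega>) \<in> borel_measurable M"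
    and "(\<integral>\<^sup>+\<omega>. f (B (\<tau> \<omega>) \<omega>) \<partial>M) = (\<integral>\<^sup>+\<omega>. (\<integral>\<^sup>+\<omega>'. f (B (\<tau> \<omega>) \<omega>') \<partial>M) \<partial>M)"
proof -
  let ?X = "\<lambda>\<omega>. \<lambda>t\<in>{0..}. B t \<omega>"
  have X [measurable]: "?X \<in> measurable M path_space" and \<tau> [measurable]: "\<tau> \<in> borel_measurable M"
    using ind by (auto simp: indep_rv_pair_def)
  have eval: "path_eval (?X \<omega>) r = B r \<omega>" if "\<omega> \<in> space M" "0 \<le> r" for \<omega> r
  proof -
    have "continuous_on {0..} (?X \<omega>)"
      using cont[OF that(1)] by (rule continuous_on_eq) simp
    then show ?thesis using that by (simp add: path_eval_eq)
  qed
  have "(\<lambda>\<omega>. path_eval (?X \<omega>) (\<tau> \<omega>)) \<in> borel_measurable M" by (rule path_eval_measurable[OF X \<tau>])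
  also have "?this \<longleftrightarrow> (\<lambda>\<omega>. B (\<tau> \<omega>) \<omega>) \<in> borel_measurable M"
    by (rule measurable_cong) (simp only: eval nonneg)
  finally show "(\<lambda>\<omega>. B (\<tau> \<omega>) \<omega>) \<in> borel_measurable M" .
  interpret X: prob_space "distr M path_space ?X" by (rule prob_space_distr) (rule X)
  interpret T: prob_space "distr M borel \<tau>" by (rule prob_space_distr) (rule \<tau>)
  interpret pair_sigma_finite "distr M path_space ?X" "distr M borel \<tau>" ..
  have f_eval: "(\<lambda>z. f (path_eval (fst z) (snd z))) \<in> borel_measurable (path_space \<Otimes>\<^sub>M borel)"
    by (intro measurable_compose[OF _ f] path_eval_measurable measurable_fst measurable_snd)
  have meas: "(\<lambda>r. \<integral>\<^sup>+p. f (path_eval p r) \<partial>distr M path_space ?X) \<in> borel_measurable borel"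
    by (rule X.borel_measurable_nn_integral)
       (auto simp: case_prod_beta' intro!: measurable_compose[OF _ f] path_eval_measurable)
  have "(\<integral>\<^sup>+\<omega>. f (B (\<tau> \<omega>) \<omega>) \<partial>M) = (\<integral>\<^sup>+\<omega>. f (path_eval (?X \<omega>) (\<tau> \<omega>)) \<partial>M)"
    by (intro nn_integral_cong) (simp only: eval nonneg)
  also have "\<dots> = (\<integral>\<^sup>+z. f (path_eval (fst z) (snd z)) \<partial>distr M (path_space \<Otimes>\<^sub>M borel) (\<lambda>\<omega>. (?X \<omega>, \<tau> \<omega>)))"
    by (subst nn_integral_distr) (use f_eval X \<tau> in auto)
  also have "distr M (path_space \<Otimes>\<^sub>M borel) (\<lambda>\<omega>. (?X \<omega>, \<tau> \<omega>)) = distr M path_space ?X \<Otimes>\<^sub>M distr M borel \<tau>"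
    using ind by (simp add: indep_rv_pair_def)
  also have "(\<integral>\<^sup>+z. f (path_eval (fst z) (snd z)) \<partial>(distr M path_space ?X \<Otimes>\<^sub>M distr M borel \<tau>)) =
      (\<integral>\<^sup>+r. (\<integral>\<^sup>+p. f (path_eval p r) \<partial>distr M path_space ?X) \<partial>distr M borel \<tau>)"
    using f_eval by (subst nn_integral_snd[symmetric]) (simp_all add: case_prod_beta')
  also have "\<dots> = (\<integral>\<^sup>+\<omega>. (\<integral>\<^sup>+p. f (path_eval p (\<tau> \<omega>)) \<partial>distr M path_space ?X) \<partial>M)"
    using meas by (subst nn_integral_distr[OF \<tau>]) simp_all
  also have "\<dots> = (\<integral>\<^sup>+\<omega>. (\<integral>\<^sup>+\<omega>'. f (path_eval (?X \<omega>') (\<tau> \<omega>)) \<partial>M) \<partial>M)"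
    by (intro nn_integral_cong nn_integral_distr[OF X] measurable_compose[OF _ f] path_eval_measurable)
       auto
  also have "\<dots> = (\<integral>\<^sup>+\<omega>. (\<integral>\<^sup>+\<omega>'. f (B (\<tau> \<omega>) \<omega>') \<partial>M) \<partial>M)"
    by (intro nn_integral_cong) (simp only: eval nonneg)
  finally show "(\<integral>\<^sup>+\<omega>. f (B (\<tau> \<omega>) \<omega>) \<partial>M) = (\<integral>\<^sup>+\<omega>. (\<integral>\<^sup>+\<omega>'. f (B (\<tau> \<omega>) \<omega>') \<partial>M) \<partial>M)" .
qed

text \<open>Mean and covariance at \<open>s = t = r\<close> fix the two parameters. A constant
  variable would have second moment 0, contradicting \<open>r > 0\<close>.\<close>

lemma fractional_brownian_motion_marginal:
  assumes B: "fractional_brownian_motion M H B" and r: "0 < r" and H: "0 < H"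
  shows "distributed M lborel (B r) (\<lambda>x. ennreal (normal_density 0 (r powr H) x))"
proof -
  have "gaussian_rv M (\<lambda>\<omega>. \<Sum>t\<in>{r}. 1 * B t \<omega>)"
    using B r unfolding fractional_brownian_motion_def gaussian_process_def
    by (elim conjE allE[of _ "{r}"] allE[of _ "\<lambda>_. 1"]) auto
  then have g: "gaussian_rv M (B r)" by simp
  have mean: "expectation (B r) = 0"
    using B less_imp_le[OF r] unfolding fractional_brownian_motion_def by blast
  have "expectation (\<lambda>\<omega>. B r \<omega> * B r \<omega>) =
      1 / 2 * (\<bar>r\<bar> powr (2 * H) + \<bar>r\<bar> powr (2 * H) - \<bar>r - r\<bar> powr (2 * H))"
    using B less_imp_le[OF r] unfolding fractional_brownian_motion_def by blast
  then have var: "expectation (\<lambda>\<omega>. B r \<omega> * B r \<omega>) = (r powr H)\<^sup>2"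
    using r by (simp add: powr_2H)
  have pos: "(r powr H)\<^sup>2 > 0" using r by simp
  from g consider (normal) \<mu> \<sigma> where "0 < \<sigma>" "distributed M lborel (B r) (\<lambda>x. ennreal (normal_density \<mu> \<sigma> x))"
    | (const) c where "AE \<omega> in M. B r \<omega> = c"
    unfolding gaussian_rv_def by blast
  then show ?thesis
  proof cases
    case normal
    have "\<mu> = 0" using normal_distributed_expectation[OF normal] mean by simp
    moreover have "variance (B r) = \<sigma>\<^sup>2" by (rule normal_distributed_variance[OF normal])
    then have "\<sigma>\<^sup>2 = (r powr H)\<^sup>2" using mean var by (simp add: power2_eq_square)
    then have "\<sigma> = r powr H" using normal(1) by (simp add: power2_eq_iff_nonneg)
    ultimately show ?thesis using normal(2) by simp
  next
    case const
    have m: "B r \<in> borel_measurable M" using g by (simp add: gaussian_rv_def)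
    have "expectation (B r) = expectation (\<lambda>_. c)"
      using const m by (intro integral_cong_AE) auto
    then have "c = 0" using mean by (simp add: prob_space)
    then have "expectation (\<lambda>\<omega>. B r \<omega> * B r \<omega>) = expectation (\<lambda>_. 0)"
      using const m by (intro integral_cong_AE) auto
    then show ?thesis using var pos by simp
  qed
qed

text \<open>Given the value \<open>z\<close> of \<open>W\<close>, the time is
  \<open>\<bar>z\<bar> powr (1 / H)\<close>, whose \<open>H\<close>-th power is
  \<open>\<bar>z\<bar>\<close>. Hence the conditional law is normal with standard deviation
  \<open>\<bar>z\<bar>\<close>, and the density is the mixture over \<open>z\<close>.\<close>

lemma distributed_random_time:
  fixes B :: "real \<Rightarrow> 'a \<Rightarrow> real"
  assumes B: "fractional_brownian_motion M H B" and H: "0 < H"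
    and ind: "indep_rv_pair M path_space (\<lambda>\<omega>. \<lambda>t\<in>{0..}. B t \<omega>) borel W"
    and W: "distributed M lborel W g"
  shows "distributed M lborel (\<lambda>\<omega>. B (\<bar>W \<omega>\<bar> powr (1 / H)) \<omega>)
    (\<lambda>x. \<integral>\<^sup>+z. g z * ennreal (normal_density 0 \<bar>z\<bar> x) \<partial>lborel)"
proof -
  let ?\<tau> = "\<lambda>\<omega>. \<bar>W \<omega>\<bar> powr (1 / H)" and ?N = "\<lambda>z x. ennreal (normal_density 0 \<bar>z\<bar> x)"
  have ind': "indep_rv_pair M path_space (\<lambda>\<omega>. \<lambda>t\<in>{0..}. B t \<omega>) borel ?\<tau>"
    using indep_rv_pair_compose[OF ind, of "\<lambda>p. p" path_space "\<lambda>w. \<bar>w\<bar> powr (1 / H)" borel] by simp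
  have cont: "continuous_on {0..} (\<lambda>t. B t \<omega>)" if "\<omega> \<in> space M" for \<omega>
    using B that by (simp add: fractional_brownian_motion_def)
  note rt = nn_integral_random_time[OF ind' cont]
  have [measurable]: "(\<lambda>\<omega>. B (?\<tau> \<omega>) \<omega>) \<in> borel_measurable M"
    by (rule rt(1)[where f = "\<lambda>_. 0"]) auto
  have g [measurable]: "g \<in> borel_measurable borel" using distributed_borel_measurable[OF W] by simp
  have N [measurable]: "(\<lambda>(z, x). ?N z x) \<in> borel_measurable (borel \<Otimes>\<^sub>M borel)"
    unfolding normal_density_def by measurable
  \<comment> \<open>At \<open>W = 0\<close> the evaluation time is 0 and the marginal is degenerate;
    having a density, \<open>W\<close> avoids this value almost surely.\<close>
  have W0: "AE \<omega> in M. W \<omega> \<noteq> 0"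
    by (subst distributed_AE2[OF W]) (use AE_lborel_singleton[of "0::real"] in auto)
  have integral: "(\<integral>\<^sup>+\<omega>. f (B (?\<tau> \<omega>) \<omega>) \<partial>M) = (\<integral>\<^sup>+x. (\<integral>\<^sup>+z. g z * ?N z x \<partial>lborel) * f x \<partial>lborel)"
    if f [measurable]: "f \<in> borel_measurable borel" for f
  proof -
    have "(\<integral>\<^sup>+\<omega>. f (B (?\<tau> \<omega>) \<omega>) \<partial>M) = (\<integral>\<^sup>+\<omega>. (\<integral>\<^sup>+\<omega>'. f (B (?\<tau> \<omega>) \<omega>') \<partial>M) \<partial>M)"
      using f by (intro rt(2)) auto
    also have "\<dots> = (\<integral>\<^sup>+\<omega>. (\<integral>\<^sup>+x. ?N (W \<omega>) x * f x \<partial>lborel) \<partial>M)"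
    proof (rule nn_integral_cong_AE, use W0 in eventually_elim)
      fix \<omega> assume "W \<omega> \<noteq> 0"
      moreover from this have "?\<tau> \<omega> powr H = \<bar>W \<omega>\<bar>" using H by (simp add: powr_powr)
      ultimately show "(\<integral>\<^sup>+\<omega>'. f (B (?\<tau> \<omega>) \<omega>') \<partial>M) = (\<integral>\<^sup>+x. ?N (W \<omega>) x * f x \<partial>lborel)"
        using fractional_brownian_motion_marginal[OF B _ H, of "?\<tau> \<omega>"]
        by (subst distributed_nn_integral[of M lborel "B (?\<tau> \<omega>)", symmetric]) auto
    qed
    also have "\<dots> = (\<integral>\<^sup>+z. g z * (\<integral>\<^sup>+x. ?N z x * f x \<partial>lborel) \<partial>lborel)"
      by (subst distributed_nn_integral[OF W]) auto
    also have "\<dots> = (\<integral>\<^sup>+z. (\<integral>\<^sup>+x. g z * ?N z x * f x \<partial>lborel) \<partial>lborel)"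
      by (subst nn_integral_cmult[symmetric]) (auto simp: mult_ac)
    also have "\<dots> = (\<integral>\<^sup>+x. (\<integral>\<^sup>+z. g z * ?N z x * f x \<partial>lborel) \<partial>lborel)"
      by (rule lborel_pair.Fubini') measurable
    also have "\<dots> = (\<integral>\<^sup>+x. (\<integral>\<^sup>+z. g z * ?N z x \<partial>lborel) * f x \<partial>lborel)"
      by (subst nn_integral_multc) auto
    finally show ?thesis .
  qed
  show ?thesis
    unfolding distributed_def
  proof (intro conjI measure_eqI)
    fix A assume "A \<in> sets (distr M lborel (\<lambda>\<omega>. B (?\<tau> \<omega>) \<omega>))"
    then have A [measurable]: "A \<in> sets borel" by simp
    have "emeasure (distr M lborel (\<lambda>\<omega>. B (?\<tau> \<omega>) \<omega>)) A = (\<integral>\<^sup>+\<omega>. indicator A (B (?\<tau> \<omega>) \<omega>) \<partial>M)"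
      using A by (subst nn_integral_distr[of _ M lborel, symmetric]) auto
    also have "\<dots> = (\<integral>\<^sup>+x. (\<integral>\<^sup>+z. g z * ?N z x \<partial>lborel) * indicator A x \<partial>lborel)"
      by (rule integral) measurable
    also have "\<dots> = emeasure (density lborel (\<lambda>x. \<integral>\<^sup>+z. g z * ?N z x \<partial>lborel)) A"
      by (subst emeasure_density) auto
    finally show "emeasure (distr M lborel (\<lambda>\<omega>. B (?\<tau> \<omega>) \<omega>)) A =
        emeasure (density lborel (\<lambda>x. \<integral>\<^sup>+z. g z * ?N z x \<partial>lborel)) A" .
  qed auto
qed

end

section \<open>The law of the iterated process\<close>

lemma nn_integral_even:
  fixes f :: "real \<Rightarrow> ennreal"
  assumes [measurable]: "f \<in> borel_measurable borel" and even: "\<And>x. f (- x) = f x"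
  shows "(\<integral>\<^sup>+x. f x \<partial>lborel) = 2 * (\<integral>\<^sup>+x\<in>{0<..}. f x \<partial>lborel)"
proof -
  have "(\<integral>\<^sup>+x. f x \<partial>lborel) = (\<integral>\<^sup>+x. f x * indicator {0<..} x + f x * indicator {..<0} x \<partial>lborel)"
    by (intro nn_integral_cong_AE, use AE_lborel_singleton[of "0::real"] in eventually_elim)
       (auto split: split_indicator)
  also have "\<dots> = (\<integral>\<^sup>+x\<in>{0<..}. f x \<partial>lborel) + (\<integral>\<^sup>+x\<in>{..<0}. f x \<partial>lborel)"
    by (rule nn_integral_add) measurable
  also have "(\<integral>\<^sup>+x\<in>{..<0}. f x \<partial>lborel) = (\<integral>\<^sup>+x\<in>{0<..}. f x \<partial>lborel)"
    by (subst nn_integral_real_affine[where c = "-1" and t = 0])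
       (auto intro!: nn_integral_cong simp: even split: split_indicator)
  finally show ?thesis by (simp add: mult_2)
qed

text \<open>Both integrands are even, and folding the two integrals onto the half-line produces the
  factor 4.\<close>

lemma p2_eq_normal_mixture:
  assumes "t > 0"
  shows "(\<integral>\<^sup>+s. (\<integral>\<^sup>+z. ennreal (normal_density 0 (t powr H) z) * ennreal (normal_density 0 \<bar>z\<bar> s) \<partial>lborel) *
    ennreal (normal_density 0 \<bar>s\<bar> x) \<partial>lborel) = p2 H x t" (is "(\<integral>\<^sup>+s. ?I s * _ \<partial>lborel) = _")
proof -
  have [measurable]: "(\<lambda>s. ?I s * ennreal (normal_density 0 \<bar>s\<bar> x)) \<in> borel_measurable borel"
    unfolding normal_density_def by measurable
  have I_eq: "?I s = 2 * (\<integral>\<^sup>+ z\<in>{0<..}. ennreal (exp (- (s\<^sup>2 / (2 * z\<^sup>2))) / sqrt (2 * pi * z\<^sup>2)) *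
       ennreal (exp (- (z\<^sup>2 / (2 * t powr (2 * H)))) / sqrt (2 * pi * t powr (2 * H))) \<partial>lborel)" (is "_ = 2 * ?J s") for s
  proof -
    have "?I s = 2 * (\<integral>\<^sup>+z\<in>{0<..}. ennreal (normal_density 0 (t powr H) z) * ennreal (normal_density 0 \<bar>z\<bar> s) \<partial>lborel)"
      by (rule nn_integral_even) (auto simp: normal_density_def)
    also have "(\<integral>\<^sup>+z\<in>{0<..}. ennreal (normal_density 0 (t powr H) z) * ennreal (normal_density 0 \<bar>z\<bar> s) \<partial>lborel) = ?J s"
      unfolding powr_2H[OF assms] by (intro nn_integral_cong) (simp add: normal_density_def mult_ac)
    finally show ?thesis .
  qed
  have "(\<integral>\<^sup>+s. ?I s * ennreal (normal_density 0 \<bar>s\<bar> x) \<partial>lborel) =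
      2 * (\<integral>\<^sup>+s\<in>{0<..}. ?I s * ennreal (normal_density 0 \<bar>s\<bar> x) \<partial>lborel)"
    by (rule nn_integral_even) (auto simp: normal_density_def)
  also have "\<dots> =
      2 * (\<integral>\<^sup>+s. 2 * (ennreal (exp (- (x\<^sup>2 / (2 * s\<^sup>2))) / sqrt (2 * pi * s\<^sup>2)) * ?J s * indicator {0<..} s) \<partial>lborel)"
    unfolding I_eq
    by (intro arg_cong[where f = "(*) 2"] nn_integral_cong) (simp add: normal_density_def mult_ac)
  also have "\<dots> = 2 * (2 * (\<integral>\<^sup>+s\<in>{0<..}. ennreal (exp (- (x\<^sup>2 / (2 * s\<^sup>2))) / sqrt (2 * pi * s\<^sup>2)) * ?J s \<partial>lborel))"
    by (subst nn_integral_cmult) auto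
  also have "\<dots> = p2 H x t"
    unfolding p2_def by (simp add: mult.assoc[symmetric])
  finally show ?thesis .
qed

lemma distributed_cong:
  assumes "\<And>\<omega>. \<omega> \<in> space M \<Longrightarrow> X \<omega> = Y \<omega>" and "distributed M N X f"
  shows "distributed M N Y f"
proof -
  have "X \<in> measurable M N \<longleftrightarrow> Y \<in> measurable M N" by (rule measurable_cong) fact
  moreover have "distr M N X = distr M N Y" by (rule distr_cong) (simp_all add: assms)
  ultimately show ?thesis using assms(2) by (simp add: distributed_def)
qed

text \<open>\<open>distributed_random_time\<close> is applied from the inside out, first with
  \<open>B 3 t\<close> and then with the resulting value of the second process as the random
  variable that determines the time.\<close>

lemma iterated_fbm_distributed:
  assumes "prob_space M" and H: "0 < H"
    and B: "\<And>i. i \<in> {1, 2, 3} \<Longrightarrow> fractional_brownian_motion M H (B i)"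
    and ind: "independent_processes M {1, 2, 3} B" and t: "t > 0"
  shows "distributed M lborel (iterated_fbm H B t) (\<lambda>x. p2 H x t)"
proof -
  interpret prob_space M by fact
  let ?X = "\<lambda>i \<omega>. \<lambda>t\<in>{0..}. B i t \<omega>"
  have X: "indep_vars (\<lambda>_. path_space) ?X {1, 2, 3}"
    using ind by (simp add: independent_processes_def)
  have comp: "(\<lambda>q. q i) \<in> measurable (PiM I (\<lambda>_. path_space)) path_space" if "i \<in> I" for i :: nat and I
    using that by (rule measurable_component_singleton)
  have at_t [measurable]: "(\<lambda>p. p t) \<in> borel_measurable path_space"
    using t by (intro measurable_component_singleton) simp
  \<comment> \<open>Disjoint blocks of indices give independent pairs: {2} against {3} for the inner
    step, {1} against {2, 3} for the outer one.\<close>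
  note ind_sub = indep_rv_pair_compose[OF indep_var_imp_indep_rv_pair[OF indep_var_restrict[OF X]]]
  have "indep_rv_pair M path_space (\<lambda>\<omega>. (\<lambda>i\<in>{2}. ?X i \<omega>) 2) borel (\<lambda>\<omega>. (\<lambda>i\<in>{3}. ?X i \<omega>) 3 t)"
    by (intro ind_sub comp measurable_compose[OF comp at_t]) auto
  then have ind2: "indep_rv_pair M path_space (?X 2) borel (B 3 t)"
    using t by simp
  \<comment> \<open>For the outer step the inner value must be a measurable function of the paths 2
    and 3; \<open>path_eval\<close> supplies one, and continuity of the paths gives the agreement
    \<open>W\<close>.\<close>
  let ?F = "\<lambda>q :: nat \<Rightarrow> real \<Rightarrow> real. path_eval (q 2) (\<bar>q 3 t\<bar> powr (1 / H))"
  have F: "?F \<in> borel_measurable (PiM {2, 3} (\<lambda>_. path_space))"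
  proof (rule path_eval_measurable)
    have [measurable]: "(\<lambda>q. q 3 t) \<in> borel_measurable (PiM {2, 3 :: nat} (\<lambda>_. path_space))"
      by (rule measurable_compose[OF comp at_t]) simp
    show "(\<lambda>q. \<bar>q 3 t\<bar> powr (1 / H)) \<in> borel_measurable (PiM {2, 3 :: nat} (\<lambda>_. path_space))"
      by measurable
  qed (rule comp, simp)
  let ?W = "\<lambda>\<omega>. ?F (\<lambda>i\<in>{2, 3}. ?X i \<omega>)"
  have "indep_rv_pair M path_space (\<lambda>\<omega>. (\<lambda>i\<in>{1}. ?X i \<omega>) 1) borel ?W"
    by (intro ind_sub[where g = ?F] comp F) auto
  then have ind1: "indep_rv_pair M path_space (?X 1) borel ?W"
    by simp
  have W: "B 2 (\<bar>B 3 t \<omega>\<bar> powr (1 / H)) \<omega> = ?W \<omega>" if "\<omega> \<in> space M" for \<omega>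
  proof -
    have "continuous_on {0..} (\<lambda>t. B 2 t \<omega>)"
      using B[of 2] that by (simp add: fractional_brownian_motion_def)
    then have "continuous_on {0..} (?X 2 \<omega>)" by (rule continuous_on_eq) simp
    then show ?thesis using t by (simp add: path_eval_eq)
  qed
  have "distributed M lborel (B 3 t) (\<lambda>x. ennreal (normal_density 0 (t powr H) x))"
    using B[of 3] t H by (intro fractional_brownian_motion_marginal) auto
  from distributed_random_time[OF B[of 2] H ind2 this]
  have "distributed M lborel (\<lambda>\<omega>. B 2 (\<bar>B 3 t \<omega>\<bar> powr (1 / H)) \<omega>)
      (\<lambda>s. \<integral>\<^sup>+z. ennreal (normal_density 0 (t powr H) z) * ennreal (normal_density 0 \<bar>z\<bar> s) \<partial>lborel)"
    by simp
  from distributed_random_time[OF B[of 1] H ind1 distributed_cong[OF W this]]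
  have "distributed M lborel (\<lambda>\<omega>. B 1 (\<bar>?W \<omega>\<bar> powr (1 / H)) \<omega>) (\<lambda>x. p2 H x t)"
    by (simp only: p2_eq_normal_mixture[OF t] insertI1)
  then show ?thesis
    by (rule distributed_cong[rotated]) (simp only: iterated_fbm_def W)
qed

theorem theorem3p2:
  fixes M :: "'a measure" and H :: real and B :: "nat \<Rightarrow> real \<Rightarrow> 'a \<Rightarrow> real"
  assumes "prob_space M"
    and "0 < H" and "H < 1"
    and "\<And>i. i \<in> {1, 2, 3} \<Longrightarrow> fractional_brownian_motion M H (B i)"
    and "independent_processes M {1, 2, 3} B"
  shows "(\<forall>t>0. distributed M lborel (iterated_fbm H B t) (\<lambda>x. p2 H x t)) \<and>
    (\<forall>x. \<forall>t>0. p2 H x t =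
       2 * (\<integral>\<^sup>+ s\<in>{0<..}.
              ennreal (exp (- (x\<^sup>2 / (2 * s\<^sup>2))) / sqrt (2 * pi * s\<^sup>2)) *
              ennreal (1 / (pi * t powr H) * bessel_K0 (s / t powr H))
            \<partial>lborel)) \<and>
    (\<forall>x t. x \<noteq> 0 \<and> t > 0 \<longrightarrow>
       p2 H x t < \<infinity> \<and>
       (let p = (\<lambda>x t. enn2real (p2 H x t));
            dx = (\<lambda>k. (deriv ^^ k) (\<lambda>y. p y t))
        in (\<forall>k<4. dx k differentiable (at x)) \<and>
           ((\<lambda>u. p x u) has_real_derivative
              H * t powr (2 * H - 1) *
                (4 * dx 2 x + 5 * x * dx 3 x + x\<^sup>2 * dx 4 x)) (at t)))"
proof (intro conjI)
  show "\<forall>t>0. distributed M lborel (iterated_fbm H B t) (\<lambda>x. p2 H x t)"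
    using iterated_fbm_distributed[OF assms(1,2) _ assms(5)] assms(4) by blast
qed (use p2_eq_bessel p2_pde in blast)+

end
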